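(* Let $G$ be a finite group, let $\mathsf{S}$ be a supercharacter theory of $G$, and let $M\le N$ be $\mathsf{S}$-normal subgroups of $G$. The following are equivalent: (1) $\mathsf{S}$ is a $\Delta$-product over $M$ and $N$; (2) for each $g\in G\setminus N$, $|\mathrm{cl}_{\mathsf{S}}(g)|=|\mathrm{cl}_{\mathsf{S}_{G/M}}(gM)|\,|M|$; (3) for each $g\in G\setminus N$, $\chi(g)=0$ for each $\chi\in\mathrm{Irr}(\mathsf{S}\mid M)$; (4) $\mathbf{V}(\mathsf{S}\mid M)\le N$; (5) for each $g\in G\setminus N$ and $m\in M$, there exists $k\in\mathrm{cl}_{\mathsf{S}}(g)$ such that $g^{-1}k=m$.
   Context: All groups are finite. For $X\subseteq\mathrm{Irr}(G)$ write $\sigma_X=\sum_{\xi\in X}\xi(1)\xi$. A supercharacter theory $\mathsf{S}$ of $G$ is a subspace of the space of complex class functions of $G$ that is a unital subalgebra both for the pointwise product and for the convolution product $(\alpha\ast\beta)(g)=\frac{1}{|G|}\sum_{x\in G}\alpha(xg)\beta(x^{-1})$ (so it contains both identity elements). Equivalently, it is given by a partition $\mathrm{Cl}(\mathsf{S})$ of $G$ into "$\mathsf{S}$-classes" (superclasses) with $\{1\}\in\mathrm{Cl}(\mathsf{S})$, together with a partition $\mathcal{X}$ of $\mathrm{Irr}(G)$ with $|\mathcal{X}|=|\mathrm{Cl}(\mathsf{S})|$, such that each $\sigma_X$ ($X\in\mathcal{X}$) is constant on each $\mathsf{S}$-class; the subspace is the span of the $\sigma_X$. The set of supercharacters ($\mathsf{S}$-irreducible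 characters) is $\mathrm{Irr}(\mathsf{S})=\{\sigma_X: X\in\mathcal{X}\}$. $\mathrm{cl}_{\mathsf{S}}(g)$ denotes the $\mathsf{S}$-class containing $g$. A subgroup $N\le G$ is $\mathsf{S}$-normal if it is a union of $\mathsf{S}$-classes (it is then normal in $G$). For $\mathsf{S}$-normal $N$: $\mathsf{S}_N$ is the supercharacter theory of $N$ whose classes are the $\mathsf{S}$-classes contained in $N$; $\mathsf{S}_{G/N}$ is the supercharacter theory of $G/N$ whose classes are the images of the $\mathsf{S}$-classes under $G\to G/N$ and whose supercharacters are the $\chi\in\mathrm{Irr}(\mathsf{S})$ with $N\subseteq\ker\chi$, viewed as characters of $G/N$. $\mathrm{Irr}(\mathsf{S}\mid N)$ is the set of $\chi\in\mathrm{Irr}(\mathsf{S})$ with $N\nsubseteq\ker\chi$, and $\mathbf{V}(\mathsf{S}\mid N)$ is the subgroup of $G$ generated by all $g\in G$ for which there exists $\chi\in\mathrm{Irr}(\mathsf{S}\mid N)$ with $\chi(g)\ne0$. For $\mathsf{S}$-normal $M\le N$, $\mathsf{S}$ is a $\Delta$-product over $M$ and $N$ if $\mathsf{S}=\mathsf{S}_N\mathop{\Delta}\mathsf{S}_{G/M}$, where the latter is the supercharacter theory of $G$ whose classes are the $\mathsf{S}_N$-classes together with the preimages in $G$ of the $\mathsf{S}_{G/M}$-classes not contained in $N/M$; equivalently, every $\mathsf{S}$-class lying outside $N$ is a union of cosets of $M$. *)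

theory Defs
  imports
    "HOL-Algebra.Generated_Groups"
    "HOL-Library.Disjoint_Sets"
    "Jordan_Normal_Form.VS_Connect"
begin

text \<open>
  Groups are HOL-Algebra groups. A complex-valued function on a group \<open>G\<close> is a function on the
  whole type that is \<open>0\<close> outside \<open>carrier G\<close>, so that equality of functions on \<open>G\<close> is equality
  of HOL functions.
\<close>

section \<open>Irreducible complex characters\<close>

abbreviation GL :: "nat \<Rightarrow> complex mat monoid" where
  "GL n \<equiv> units_of (ring_mat TYPE(complex) n ())"

definition irreducible_rep ::
    "('a, 'b) monoid_scheme \<Rightarrow> nat \<Rightarrow> ('a \<Rightarrow> complex mat) \<Rightarrow> bool" where
  "irreducible_rep G n \<rho> \<longleftrightarrow>
     \<rho> \<in> hom G (GL n) \<and> n > 0 \<and>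
     (\<forall>W. VectorSpace.subspace class_ring W (module_vec TYPE(complex) n) \<and>
          (\<forall>g\<in>carrier G. \<forall>w\<in>W. \<rho> g *\<^sub>v w \<in> W)
        \<longrightarrow> W = {0\<^sub>v n} \<or> W = carrier_vec n)"

definition rep_character ::
    "('a, 'b) monoid_scheme \<Rightarrow> nat \<Rightarrow> ('a \<Rightarrow> complex mat) \<Rightarrow> 'a \<Rightarrow> complex" where
  "rep_character G n \<rho> = (\<lambda>g. if g \<in> carrier G then (\<Sum>i<n. \<rho> g $$ (i, i)) else 0)"

definition Irr :: "('a, 'b) monoid_scheme \<Rightarrow> ('a \<Rightarrow> complex) set" where
  "Irr G = {rep_character G n \<rho> | n \<rho>. irreducible_rep G n \<rho>}"

definition char_kernel :: "('a, 'b) monoid_scheme \<Rightarrow> ('a \<Rightarrow> complex) \<Rightarrow> 'a set" where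
  "char_kernel G \<chi> = {g \<in> carrier G. \<chi> g = \<chi> \<one>\<^bsub>G\<^esub>}"

definition sigma_char ::
    "('a, 'b) monoid_scheme \<Rightarrow> ('a \<Rightarrow> complex) set \<Rightarrow> 'a \<Rightarrow> complex" where
  "sigma_char G X = (\<lambda>g. \<Sum>\<xi>\<in>X. \<xi> \<one>\<^bsub>G\<^esub> * \<xi> g)"

section \<open>Supercharacter theories\<close>

definition class_functions :: "('a, 'b) monoid_scheme \<Rightarrow> ('a \<Rightarrow> complex) set" where
  "class_functions G =
     {f. (\<forall>g. g \<notin> carrier G \<longrightarrow> f g = 0) \<and>
         (\<forall>g\<in>carrier G. \<forall>x\<in>carrier G. f (inv\<^bsub>G\<^esub> x \<otimes>\<^bsub>G\<^esub> g \<otimes>\<^bsub>G\<^esub> x) = f g)}"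

definition convolution ::
    "('a, 'b) monoid_scheme \<Rightarrow> ('a \<Rightarrow> complex) \<Rightarrow> ('a \<Rightarrow> complex) \<Rightarrow> 'a \<Rightarrow> complex" where
  "convolution G \<alpha> \<beta> =
     (\<lambda>g. if g \<in> carrier G
          then (\<Sum>x\<in>carrier G. \<alpha> (x \<otimes>\<^bsub>G\<^esub> g) * \<beta> (inv\<^bsub>G\<^esub> x)) / of_nat (card (carrier G))
          else 0)"

text \<open>
  The identity of the pointwise product is the constant \<open>1\<close> on \<open>G\<close>; because of the factor
  \<open>1/|G|\<close>, the identity of the convolution product is \<open>|G|\<close> times the indicator of \<open>1\<close>.
\<close>

definition supercharacter_theory ::
    "('a, 'b) monoid_scheme \<Rightarrow> ('a \<Rightarrow> complex) set \<Rightarrow> bool" where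
  "supercharacter_theory G S \<longleftrightarrow>
     S \<subseteq> class_functions G \<and>
     (\<lambda>_. 0) \<in> S \<and>
     (\<forall>\<alpha>\<in>S. \<forall>\<beta>\<in>S. (\<lambda>g. \<alpha> g + \<beta> g) \<in> S) \<and>
     (\<forall>c. \<forall>\<alpha>\<in>S. (\<lambda>g. c * \<alpha> g) \<in> S) \<and>
     (\<forall>\<alpha>\<in>S. \<forall>\<beta>\<in>S. (\<lambda>g. \<alpha> g * \<beta> g) \<in> S) \<and>
     (\<forall>\<alpha>\<in>S. \<forall>\<beta>\<in>S. convolution G \<alpha> \<beta> \<in> S) \<and>
     (\<lambda>g. if g \<in> carrier G then 1 else 0) \<in> S \<and>
     (\<lambda>g. if g = \<one>\<^bsub>G\<^esub> then of_nat (card (carrier G)) else 0) \<in> S"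

text \<open>
  The superclasses are the maximal subsets of \<open>G\<close> on which all members of \<open>S\<close> are constant.
\<close>

definition superclass ::
    "('a, 'b) monoid_scheme \<Rightarrow> ('a \<Rightarrow> complex) set \<Rightarrow> 'a \<Rightarrow> 'a set" where
  "superclass G S g = {h \<in> carrier G. \<forall>\<alpha>\<in>S. \<alpha> h = \<alpha> g}"

definition Cl :: "('a, 'b) monoid_scheme \<Rightarrow> ('a \<Rightarrow> complex) set \<Rightarrow> 'a set set" where
  "Cl G S = superclass G S ` carrier G"

definition irr_partition ::
    "('a, 'b) monoid_scheme \<Rightarrow> ('a \<Rightarrow> complex) set \<Rightarrow> ('a \<Rightarrow> complex) set set \<Rightarrow> bool" where
  "irr_partition G S \<X> \<longleftrightarrow>
     partition_on (Irr G) \<X> \<and>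
     card \<X> = card (Cl G S) \<and>
     (\<forall>X\<in>\<X>. \<forall>K\<in>Cl G S. \<forall>g\<in>K. \<forall>h\<in>K. sigma_char G X g = sigma_char G X h) \<and>
     S = {\<lambda>g. \<Sum>X\<in>\<X>. c X * sigma_char G X g | c. True}"

text \<open>
  For a supercharacter theory \<open>S\<close> of a finite group there is exactly one such partition
  (Diaconis and Isaacs), so the description below is not vacuous.
\<close>

definition supercharacters ::
    "('a, 'b) monoid_scheme \<Rightarrow> ('a \<Rightarrow> complex) set \<Rightarrow> ('a \<Rightarrow> complex) set" where
  "supercharacters G S = sigma_char G ` (THE \<X>. irr_partition G S \<X>)"

definition S_normal ::
    "('a, 'b) monoid_scheme \<Rightarrow> ('a \<Rightarrow> complex) set \<Rightarrow> 'a set \<Rightarrow> bool" where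
  "S_normal G S N \<longleftrightarrow> subgroup N G \<and> (\<exists>\<K>\<subseteq>Cl G S. N = \<Union>\<K>)"

definition supercharacters_over ::
    "('a, 'b) monoid_scheme \<Rightarrow> ('a \<Rightarrow> complex) set \<Rightarrow> 'a set \<Rightarrow> ('a \<Rightarrow> complex) set" where
  "supercharacters_over G S N = {\<chi> \<in> supercharacters G S. \<not> N \<subseteq> char_kernel G \<chi>}"

definition vanishing_off_subgroup ::
    "('a, 'b) monoid_scheme \<Rightarrow> ('a \<Rightarrow> complex) set \<Rightarrow> 'a set \<Rightarrow> 'a set" where
  "vanishing_off_subgroup G S N =
     generate G {g \<in> carrier G. \<exists>\<chi>\<in>supercharacters_over G S N. \<chi> g \<noteq> 0}"

section \<open>Restriction, deflation and the Delta-product\<close>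

text \<open>
  A supercharacter theory is determined by its superclasses: it is the space of all functions
  on the group that are constant on each of them.
\<close>

definition theory_with_classes ::
    "('a, 'b) monoid_scheme \<Rightarrow> 'a set set \<Rightarrow> ('a \<Rightarrow> complex) set" where
  "theory_with_classes G \<K> =
     {f. (\<forall>g. g \<notin> carrier G \<longrightarrow> f g = 0) \<and> (\<forall>K\<in>\<K>. \<forall>g\<in>K. \<forall>h\<in>K. f g = f h)}"

definition restricted_theory ::
    "('a, 'b) monoid_scheme \<Rightarrow> ('a \<Rightarrow> complex) set \<Rightarrow> 'a set \<Rightarrow> ('a \<Rightarrow> complex) set" where
  "restricted_theory G S N = theory_with_classes (G\<lparr>carrier := N\<rparr>) {K \<in> Cl G S. K \<subseteq> N}"

definition quotient_theory ::
    "('a, 'b) monoid_scheme \<Rightarrow> ('a \<Rightarrow> complex) set \<Rightarrow> 'a set \<Rightarrow> ('a set \<Rightarrow> complex) set" where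
  "quotient_theory G S N = theory_with_classes (G Mod N) ((\<lambda>K. (\<lambda>g. N #>\<^bsub>G\<^esub> g) ` K) ` Cl G S)"

definition delta_product ::
    "('a, 'b) monoid_scheme \<Rightarrow> 'a set \<Rightarrow> 'a set \<Rightarrow> ('a \<Rightarrow> complex) set \<Rightarrow>
      ('a set \<Rightarrow> complex) set \<Rightarrow> ('a \<Rightarrow> complex) set" where
  "delta_product G M N T U =
     theory_with_classes G
       (Cl (G\<lparr>carrier := N\<rparr>) T \<union>
        {{g \<in> carrier G. M #>\<^bsub>G\<^esub> g \<in> D} | D.
           D \<in> Cl (G Mod M) U \<and> \<not> D \<subseteq> (\<lambda>n. M #>\<^bsub>G\<^esub> n) ` N})"

definition is_delta_product ::
    "('a, 'b) monoid_scheme \<Rightarrow> ('a \<Rightarrow> complex) set \<Rightarrow> 'a set \<Rightarrow> 'a set \<Rightarrow> bool" where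
  "is_delta_product G S M N \<longleftrightarrow>
     S = delta_product G M N (restricted_theory G S N) (quotient_theory G S M)"

end

theory Submission
  imports Defs "Jordan_Normal_Form.DL_Rank" "Jordan_Normal_Form.Spectral_Radius"
begin

text \<open>
  All the conditions say the same thing about the superclasses outside \<open>N\<close>: each of them is a
  union of cosets of \<open>M\<close>. For the elementwise condition, the cardinality condition and the
  definition of the Delta-product this is combinatorics. The superclasses of the deflation to
  \<open>G/M\<close> are the images of the superclasses \<open>K\<close> of \<open>G\<close>, and the preimage of such an image is
  the saturation \<open>KM\<close>, which has \<open>|M|\<close> times as many elements as the image; so the cardinality
  condition says that \<open>K = KM\<close> (\<open>card_condition_iff\<close>), and the Delta-product is the theory
  in which every \<open>K\<close> outside \<open>N\<close> has been replaced by \<open>KM\<close> (\<open>delta_product_eq\<close>).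

  The vanishing of the supercharacters in \<open>Irr(S | M)\<close> is connected with this by the
  averaging element \<open>e = (|G|/|M|) 1\<^sub>M\<close>, which lies in \<open>S\<close> because \<open>M\<close> is a union of
  superclasses. Convolution with \<open>e\<close> replaces a function by its averages over the cosets of
  \<open>M\<close>, and it multiplies each supercharacter \<open>\<sigma>\<^sub>X\<close> by a scalar \<open>w\<close>. If \<open>M\<close> lies in the kernel
  of \<open>\<sigma>\<^sub>X\<close>, evaluation at \<open>1\<close> gives \<open>w = 1\<close>. Hence if the supercharacters in \<open>Irr(S | M)\<close>
  vanish at \<open>g\<close>, then every supercharacter agrees at \<open>g\<close> with its average over \<open>gM\<close>. The
  supercharacters span \<open>S\<close>, so the same is true of the indicator of the superclass \<open>K\<close> of \<open>g\<close>,
  which means that \<open>gM \<subseteq> K\<close>. Conversely, if \<open>gM \<subseteq> K\<close>, then \<open>\<sigma>\<^sub>X(g) = w \<sigma>\<^sub>X(g)\<close>; so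
  \<open>\<sigma>\<^sub>X(g) \<noteq> 0\<close> forces \<open>w = 1\<close>, and then \<open>\<sigma>\<^sub>X\<close> is constant on \<open>M\<close>
  (\<open>supercharacters_over_vanish_iff\<close>). The condition on the subgroup generated by the
  non-zeros of \<open>Irr(S | M)\<close> is the same vanishing condition because \<open>N\<close> is a subgroup.

  This uses that the supercharacters are the \<open>\<sigma>\<^sub>X\<close> for a partition of \<open>Irr(G)\<close>, that they lie
  in \<open>S\<close> and that they span it. As the supercharacters are defined through the unique
  partition with these properties, its existence and uniqueness have to be proved. By the
  orthogonality relations a class function \<open>\<alpha>\<close> is determined by its central values, the
  scalars by which convolution with \<open>\<alpha>\<close> acts on the irreducible characters, and convolution
  corresponds to the pointwise product of central values. So \<open>S\<close> is an algebra of functions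
  under pointwise multiplication in two ways, on \<open>G\<close> and on \<open>Irr(G)\<close>. A unital algebra of
  functions on a finite set contains the indicators of its level classes
  (\<open>indicator_of_level_class\<close>); on \<open>G\<close> these are the superclasses, on \<open>Irr(G)\<close> the blocks of
  the partition, and comparing the two bases gives as many blocks as superclasses.

  The orthogonality relations come from Schur's lemma. That the irreducible characters span
  the class functions comes from writing the regular character as a sum of irreducible ones;
  an invariant subspace makes a representation block triangular, and its character is the sum
  of the characters of the two diagonal blocks.
\<close>

section \<open>Schur's lemma for matrix representations\<close>

lemma trace_mult_commute:
  fixes A B :: "complex mat"
  assumes A: "A \<in> carrier_mat n m" and B: "B \<in> carrier_mat m n"
  shows "(\<Sum>i<n. (A * B) $$ (i, i)) = (\<Sum>j<m. (B * A) $$ (j, j))"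
proof -
  have "(\<Sum>i<n. (A * B) $$ (i, i)) = (\<Sum>i<n. \<Sum>j<m. A $$ (i, j) * B $$ (j, i))"
    using A B by (intro sum.cong) (auto simp: scalar_prod_def atLeast0LessThan)
  also have "\<dots> = (\<Sum>j<m. \<Sum>i<n. B $$ (j, i) * A $$ (i, j))"
    by (subst sum.swap) (simp add: mult.commute)
  also have "\<dots> = (\<Sum>j<m. (B * A) $$ (j, j))"
    using A B by (intro sum.cong) (auto simp: scalar_prod_def atLeast0LessThan)
  finally show ?thesis .
qed

text \<open>
  Conditions on the matrices alone: invertibility is automatic, since \<open>\<rho>(g\<inverse>)\<close> is an inverse of
  \<open>\<rho>(g)\<close>.
\<close>

lemma hom_GL_iff:
  assumes "group G"
  shows "\<rho> \<in> hom G (GL n) \<longleftrightarrow>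
    (\<forall>g\<in>carrier G. \<rho> g \<in> carrier_mat n n) \<and>
    (\<forall>g\<in>carrier G. \<forall>h\<in>carrier G. \<rho> (g \<otimes>\<^bsub>G\<^esub> h) = \<rho> g * \<rho> h) \<and>
    \<rho> \<one>\<^bsub>G\<^esub> = 1\<^sub>m n"
proof -
  interpret group G by fact
  interpret R: ring "ring_mat TYPE(complex) n ()" by (rule ring_mat)
  show ?thesis
  proof
    assume h: "\<rho> \<in> hom G (GL n)"
    interpret group_hom G "GL n" \<rho>
      using h R.units_group by (simp add: group_hom_def group_hom_axioms_def assms)
    have "\<rho> g \<in> carrier_mat n n" if "g \<in> carrier G" for g
      using hom_in_carrier[of \<rho> G "GL n", OF h that] unfolding units_of_def Units_def by (simp add: ring_mat_simps)
    moreover have "\<rho> (g \<otimes>\<^bsub>G\<^esub> h) = \<rho> g * \<rho> h" if "g \<in> carrier G" "h \<in> carrier G" for g h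
      using hom_mult that by (simp add: units_of_def ring_mat_simps)
    moreover have "\<rho> \<one>\<^bsub>G\<^esub> = 1\<^sub>m n"
      using hom_one by (simp add: units_of_def ring_mat_simps)
    ultimately show "(\<forall>g\<in>carrier G. \<rho> g \<in> carrier_mat n n) \<and>
    (\<forall>g\<in>carrier G. \<forall>h\<in>carrier G. \<rho> (g \<otimes>\<^bsub>G\<^esub> h) = \<rho> g * \<rho> h) \<and>
    \<rho> \<one>\<^bsub>G\<^esub> = 1\<^sub>m n" by blast
  next
    assume a: "(\<forall>g\<in>carrier G. \<rho> g \<in> carrier_mat n n) \<and>
    (\<forall>g\<in>carrier G. \<forall>h\<in>carrier G. \<rho> (g \<otimes>\<^bsub>G\<^esub> h) = \<rho> g * \<rho> h) \<and>
    \<rho> \<one>\<^bsub>G\<^esub> = 1\<^sub>m n"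
    have "\<rho> g \<in> Units (ring_mat TYPE(complex) n ())" if g: "g \<in> carrier G" for g
    proof -
      have "\<rho> g * \<rho> (inv\<^bsub>G\<^esub> g) = 1\<^sub>m n" "\<rho> (inv\<^bsub>G\<^esub> g) * \<rho> g = 1\<^sub>m n"
        using a g by (metis inv_closed r_inv, metis inv_closed l_inv)
      then show ?thesis using a g by (auto simp: Units_def ring_mat_simps)
    qed
    then show "\<rho> \<in> hom G (GL n)"
      using a by (auto simp: hom_def units_of_def ring_mat_simps)
  qed
qed

lemma subspace_vecI:
  assumes "W \<subseteq> carrier_vec n" "0\<^sub>v n \<in> W"
    and "\<And>v w. v \<in> W \<Longrightarrow> w \<in> W \<Longrightarrow> v + w \<in> W"
    and "\<And>c v. v \<in> W \<Longrightarrow> c \<cdot>\<^sub>v v \<in> W"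
  shows "VectorSpace.subspace class_ring W (module_vec TYPE(complex) n)"
proof -
  interpret V: vec_space "TYPE(complex)" n .
  show ?thesis
    unfolding VectorSpace.subspace_def submodule_def
    using assms V.vectorspace_axioms V.module_axioms by (auto simp: module_vec_simps)
qed

text \<open>
  The kernel and the image of an intertwiner are invariant subspaces. For \<open>T \<noteq> 0\<close>
  irreducibility makes \<open>T\<close> injective and surjective; a right inverse \<open>B\<close> is built from
  preimages of the unit vectors, and \<open>T (B T - 1) = 0\<close> makes it a left inverse.
\<close>

lemma schur_intertwiner:
  assumes G: "group G" and irr: "irreducible_rep G n \<rho>" "irreducible_rep G m \<tau>"
    and T: "T \<in> carrier_mat n m" and com: "\<And>g. g \<in> carrier G \<Longrightarrow> \<rho> g * T = T * \<tau> g"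
  shows "T = 0\<^sub>m n m \<or> (\<exists>B\<in>carrier_mat m n. T * B = 1\<^sub>m n \<and> B * T = 1\<^sub>m m)"
proof (cases "T = 0\<^sub>m n m")
  assume nz: "T \<noteq> 0\<^sub>m n m"
  have \<rho>: "\<rho> g \<in> carrier_mat n n" and \<tau>: "\<tau> g \<in> carrier_mat m m" if "g \<in> carrier G" for g
    using irr that hom_GL_iff[OF G] unfolding irreducible_rep_def by auto
  have nz_col: "\<exists>j<m. col T j \<noteq> 0\<^sub>v n"
  proof (rule ccontr)
    assume "\<not> ?thesis"
    then have "T $$ (i, j) = 0" if "i < n" "j < m" for i j
      using that T by (metis carrier_matD index_col index_zero_vec(1))
    then show False using nz T by auto
  qed
  have col: "T *\<^sub>v unit_vec m j = col T j" if "j < m" for j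
    using T that by (intro eq_vecI) auto
  define K where "K = {v \<in> carrier_vec m. T *\<^sub>v v = 0\<^sub>v n}"
  have "VectorSpace.subspace class_ring K (module_vec TYPE(complex) m)"
    by (rule subspace_vecI)
      (use T in \<open>auto simp: K_def mult_add_distrib_mat_vec mult_mat_vec\<close>)
  moreover have "\<tau> g *\<^sub>v v \<in> K" if "g \<in> carrier G" "v \<in> K" for g v
  proof -
    have "T *\<^sub>v (\<tau> g *\<^sub>v v) = (T * \<tau> g) *\<^sub>v v"
      using T \<tau> that by (simp add: K_def assoc_mult_mat_vec[of T n m "\<tau> g" m v])
    also have "\<dots> = \<rho> g *\<^sub>v (T *\<^sub>v v)"
      unfolding com[OF that(1), symmetric]
      using T \<rho>[OF that(1)] that(2) by (intro assoc_mult_mat_vec) (auto simp: K_def)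
    also have "\<dots> = 0\<^sub>v n"
      using that(2) \<rho>[OF that(1)] by (auto simp: K_def intro!: eq_vecI)
    finally show ?thesis using that(2) \<tau>[OF that(1)] by (auto simp: K_def)
  qed
  moreover have "K \<noteq> carrier_vec m"
  proof
    assume "K = carrier_vec m"
    then have "T *\<^sub>v unit_vec m j = 0\<^sub>v n" for j
      unfolding K_def using unit_vec_carrier by blast
    then show False using nz_col col by metis
  qed
  ultimately have K: "K = {0\<^sub>v m}"
    using irr(2) unfolding irreducible_rep_def by blast
  define I where "I = {T *\<^sub>v v | v. v \<in> carrier_vec m}"
  have "VectorSpace.subspace class_ring I (module_vec TYPE(complex) n)"
  proof (rule subspace_vecI)
    show "I \<subseteq> carrier_vec n" using T by (auto simp: I_def)
    have "0\<^sub>v n = T *\<^sub>v 0\<^sub>v m" using T by (intro eq_vecI) auto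
    then show "0\<^sub>v n \<in> I"
      unfolding I_def by (intro CollectI exI[of _ "0\<^sub>v m"] conjI) auto
    show "v + w \<in> I" if vw: "v \<in> I" "w \<in> I" for v w
    proof -
      obtain a b where "a \<in> carrier_vec m" "b \<in> carrier_vec m" "v = T *\<^sub>v a" "w = T *\<^sub>v b"
        using vw unfolding I_def by blast
      then have "a + b \<in> carrier_vec m" "v + w = T *\<^sub>v (a + b)"
        using T by (simp_all add: mult_add_distrib_mat_vec[of T n m])
      then show ?thesis unfolding I_def by blast
    qed
    show "c \<cdot>\<^sub>v v \<in> I" if v: "v \<in> I" for c v
    proof -
      obtain a where "a \<in> carrier_vec m" "v = T *\<^sub>v a"
        using v unfolding I_def by blast
      then have "c \<cdot>\<^sub>v a \<in> carrier_vec m" "c \<cdot>\<^sub>v v = T *\<^sub>v (c \<cdot>\<^sub>v a)"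
        using T by (simp_all add: mult_mat_vec[of T n m])
      then show ?thesis unfolding I_def by blast
    qed
  qed
  moreover have "\<rho> g *\<^sub>v v \<in> I" if g: "g \<in> carrier G" and v: "v \<in> I" for g v
  proof -
    obtain u where u: "u \<in> carrier_vec m" "v = T *\<^sub>v u" using v by (auto simp: I_def)
    have "\<rho> g *\<^sub>v v = (\<rho> g * T) *\<^sub>v u" using u T \<rho>[OF g] by (simp add: assoc_mult_mat_vec[of "\<rho> g" n n T m u])
    also have "\<dots> = T *\<^sub>v (\<tau> g *\<^sub>v u)"
      using com[OF g] u T \<tau>[OF g] by (simp add: assoc_mult_mat_vec[of T n m "\<tau> g" m u])
    finally have "\<rho> g *\<^sub>v v = T *\<^sub>v (\<tau> g *\<^sub>v u)" .
    moreover have "\<tau> g *\<^sub>v u \<in> carrier_vec m" using u \<tau>[OF g] by simp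
    ultimately show ?thesis unfolding I_def by blast
  qed
  moreover have "I \<noteq> {0\<^sub>v n}"
  proof -
    obtain j where j: "j < m" "col T j \<noteq> 0\<^sub>v n" using nz_col by blast
    have "T *\<^sub>v unit_vec m j \<in> I" unfolding I_def using unit_vec_carrier by blast
    then show ?thesis using j col by auto
  qed
  ultimately have I: "I = carrier_vec n"
    using irr(1) unfolding irreducible_rep_def by blast
  have "\<exists>b. b \<in> carrier_vec m \<and> T *\<^sub>v b = unit_vec n i" for i
  proof -
    have "unit_vec n i \<in> I" using I by simp
    then show ?thesis unfolding I_def by (auto dest: sym)
  qed
  then obtain b where b: "\<And>i. i < n \<Longrightarrow> b i \<in> carrier_vec m" "\<And>i. i < n \<Longrightarrow> T *\<^sub>v b i = unit_vec n i"
    by metis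
  define B where "B = mat_of_cols m (map b [0..<n])"
  have B: "B \<in> carrier_mat m n" by (intro carrier_matI) (auto simp: B_def)
  have colB: "col B i = b i" if "i < n" for i
    using that b(1) by (simp add: B_def)
  have TB: "T * B = 1\<^sub>m n"
  proof (rule mat_col_eqI)
    fix i assume "i < dim_col (1\<^sub>m n :: complex mat)"
    then have i: "i < n" by simp
    then show "col (T * B) i = col (1\<^sub>m n) i"
      using b(2)[OF i] colB[OF i] col_mult2[OF T B i] by (simp only: col_one)
  qed (use T B in auto)
  have "B * T = 1\<^sub>m m"
  proof (rule mat_col_eqI)
    fix j assume "j < dim_col (1\<^sub>m m :: complex mat)"
    then have j: "j < m" by simp
    let ?u = "B *\<^sub>v col T j"
    have c: "col T j \<in> carrier_vec n" "?u \<in> carrier_vec m" using T B by auto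
    have "T *\<^sub>v ?u = (T * B) *\<^sub>v col T j"
      by (rule assoc_mult_mat_vec[OF T B c(1), symmetric])
    then have "T *\<^sub>v ?u = T *\<^sub>v unit_vec m j"
      using c(1) TB col[OF j] by simp
    then have "?u - unit_vec m j \<in> K"
      using c T by (simp add: K_def mult_minus_distrib_mat_vec)
    then have z: "?u - unit_vec m j = 0\<^sub>v m" using K by simp
    have "?u = unit_vec m j"
    proof (rule eq_vecI)
      fix i assume "i < dim_vec (unit_vec m j :: complex vec)"
      then show "?u $ i = unit_vec m j $ i"
        using arg_cong[OF z, of "\<lambda>v. v $ i"] c by simp
    qed (use B in auto)
    then show "col (B * T) j = col (1\<^sub>m m) j"
      using col_mult2[OF B T j] j by (simp only: col_one)
  qed (use T B in auto)
  with TB B show ?thesis by blast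
qed simp

text \<open>
  Subtracting an eigenvalue from \<open>T\<close> gives an intertwiner with a nonzero kernel, which is
  therefore zero.
\<close>

lemma schur_scalar:
  assumes G: "group G" and irr: "irreducible_rep G n \<rho>"
    and T: "T \<in> carrier_mat n n" and com: "\<And>g. g \<in> carrier G \<Longrightarrow> \<rho> g * T = T * \<rho> g"
  shows "\<exists>c. T = c \<cdot>\<^sub>m 1\<^sub>m n"
proof -
  have n: "n > 0" using irr by (simp add: irreducible_rep_def)
  obtain c where "eigenvalue T c"
    using spectrum_non_empty[OF T n] by (auto simp: spectrum_def)
  then obtain v where v: "v \<in> carrier_vec n" "v \<noteq> 0\<^sub>v n" "T *\<^sub>v v = c \<cdot>\<^sub>v v"
    using T by (auto simp: eigenvalue_def eigenvector_def)
  define U where "U = T - c \<cdot>\<^sub>m 1\<^sub>m n"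
  have U: "U \<in> carrier_mat n n" using T by (auto simp: U_def)
  have "\<rho> g * U = U * \<rho> g" if g: "g \<in> carrier G" for g
  proof -
    have r: "\<rho> g \<in> carrier_mat n n"
      using irr g hom_GL_iff[OF G] unfolding irreducible_rep_def by auto
    then show ?thesis
      using T com[OF g] by (simp add: U_def mult_minus_distrib_mat[of _ n n] minus_mult_distrib_mat[of _ n n]
        mult_smult_distrib[of _ n n _ n] mult_smult_assoc_mat[of _ n n _ n])
  qed
  from schur_intertwiner[OF G irr irr U this]
  consider "U = 0\<^sub>m n n" | B where "B \<in> carrier_mat n n" "B * U = 1\<^sub>m n" by blast
  then show ?thesis
  proof cases
    case 1
    have "T $$ (i, j) = (c \<cdot>\<^sub>m 1\<^sub>m n) $$ (i, j)" if "i < n" "j < n" for i j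
      using arg_cong[OF 1, of "\<lambda>A. A $$ (i, j)"] that T by (simp add: U_def)
    then show ?thesis using T by (intro exI[of _ c]) auto
  next
    case 2
    have "U *\<^sub>v v = 0\<^sub>v n"
      using v T by (intro eq_vecI) (auto simp: U_def minus_mult_distrib_mat_vec[of _ n n])
    then have "v = 0\<^sub>v n"
      using 2 U v(1) assoc_mult_mat_vec[of B n n U n v] by auto
    then show ?thesis using v by simp
  qed
qed

section \<open>Decomposition of characters into irreducible ones\<close>

text \<open>
  The columns of \<open>P\<close> are a basis of the whole space that starts with a basis of \<open>W\<close>;
  conjugation by \<open>P\<close> turns every matrix that preserves \<open>W\<close> into a block triangular one. The
  condition on the rows of \<open>Q = P\<inverse>\<close> from \<open>k\<close> on says that vectors of \<open>W\<close> have no coordinates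
  outside the first \<open>k\<close>.
\<close>

lemma adapted_basis:
  assumes W: "VectorSpace.subspace class_ring W (module_vec TYPE(complex) n)"
  obtains k P Q where "k \<le> n" "P \<in> carrier_mat n n" "Q \<in> carrier_mat n n"
    "P * Q = 1\<^sub>m n" "Q * P = 1\<^sub>m n"
    "\<And>j. j < k \<Longrightarrow> col P j \<in> W"
    "\<And>w i. w \<in> W \<Longrightarrow> k \<le> i \<Longrightarrow> i < n \<Longrightarrow> (Q *\<^sub>v w) $ i = 0"
    "k = 0 \<Longrightarrow> W = {0\<^sub>v n}" "k = n \<Longrightarrow> W = carrier_vec n"
proof -
  interpret vec_space "TYPE(complex)" n .
  have sub: "submodule class_ring W V" using W by (simp add: VectorSpace.subspace_def)
  then have Wc: "W \<subseteq> carrier_vec n"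
    unfolding submodule_def by (simp add: module_vec_simps)
  have card_le: "finite S \<and> card S \<le> n" if "S \<subseteq> carrier_vec n" "lin_indpt S" for S
    using li_le_dim[OF fin_dim that] dim_is_n by simp
  have "lin_indpt {}" using unit_vecs_basis
    by (meson basis_def empty_subsetI subset_li_is_li)
  then obtain B where B: "finite B" "maximal B (\<lambda>S. S \<subseteq> W \<and> lin_indpt S)"
    using maximal_exists[of "\<lambda>S. S \<subseteq> W \<and> lin_indpt S" n "{}"] card_le Wc by blast
  then have BW: "B \<subseteq> W" and Bi: "lin_indpt B" by (auto simp: maximal_def)
  have Bc: "B \<subseteq> carrier_vec n" using BW Wc by blast
  have WB: "W \<subseteq> span B"
  proof
    fix w assume w: "w \<in> W"
    show "w \<in> span B"
    proof (rule ccontr)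
      assume n: "w \<notin> span B"
      then have "w \<notin> B" using in_own_span[OF Bc] by blast
      then have "lin_indpt (B \<union> {w})" "w \<notin> B"
        using lin_dep_iff_in_span[OF Bc Bi] n w Wc by blast+
      then show False using B(2) w BW unfolding maximal_def by blast
    qed
  qed
  have BspW: "span B \<subseteq> W" using span_is_subset[OF BW sub] .
  obtain A where A: "finite A" "maximal A (\<lambda>S. B \<subseteq> S \<and> S \<subseteq> carrier_vec n \<and> lin_indpt S)"
    using maximal_exists[of "\<lambda>S. B \<subseteq> S \<and> S \<subseteq> carrier_vec n \<and> lin_indpt S" n B]
      card_le Bc Bi by blast
  then have BA: "B \<subseteq> A" by (simp add: maximal_def)
  have "maximal A (\<lambda>S. S \<subseteq> carrier_vec n \<and> lin_indpt S)"
    using A(2) BA unfolding maximal_def by blast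
  then have bas: "basis A" by (rule max_li_is_basis)
  then have Ac: "A \<subseteq> carrier_vec n" and Ai: "lin_indpt A" by (auto simp: basis_def)
  have cardA: "card A = n" using dim_basis[OF A(1) bas] dim_is_n by simp
  obtain bs where bs: "set bs = B" "distinct bs" using finite_distinct_list[OF B(1)] by blast
  obtain cs where cs: "set cs = A - B" "distinct cs" using finite_distinct_list[of "A - B"] A(1) by blast
  define L where "L = bs @ cs"
  have L: "set L = A" "distinct L" using bs cs BA by (auto simp: L_def)
  then have len: "length L = n" using cardA distinct_card by metis
  define P where "P = mat_of_cols n L"
  have P: "P \<in> carrier_mat n n" using len by (simp add: P_def carrier_matI)
  have colsP: "cols P = L" using L Ac by (simp add: P_def)
  have colP: "col P j = L ! j" if "j < n" for j
    using colsP P that by (metis carrier_matD(2) cols_length cols_nth)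
  have "rank P = n" using lin_indpt_full_rank[OF P] L Ai by (simp add: colsP)
  then have "det P \<noteq> 0" using det_rank_iff[OF P] by simp
  from det_non_zero_imp_unit[OF P this, of "()"]
  obtain Q where Q: "Q \<in> carrier_mat n n" "P * Q = 1\<^sub>m n" "Q * P = 1\<^sub>m n"
    by (auto simp: Units_def ring_mat_simps)
  define k where "k = length bs"
  have kn: "k \<le> n" using len by (simp add: k_def L_def)
  have colW: "col P j \<in> W" if "j < k" for j
    using that kn BW bs by (simp add: colP L_def k_def nth_append) (meson nth_mem subsetD)
  \<comment> \<open>\<open>Q\<close> sends the first \<open>k\<close> basis vectors, which span \<open>W\<close>, to the first \<open>k\<close> unit vectors.\<close>
  define K where "K = {w \<in> carrier_vec n. \<forall>i. k \<le> i \<longrightarrow> i < n \<longrightarrow> (Q *\<^sub>v w) $ i = 0}"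
  have "VectorSpace.subspace class_ring K V"
    by (rule subspace_vecI)
      (use Q(1) in \<open>auto simp: K_def scalar_prod_add_distrib[of _ n]\<close>)
  moreover have "B \<subseteq> K"
  proof
    fix b assume b: "b \<in> B"
    then obtain j where j: "j < k" "b = bs ! j" using bs k_def by (metis in_set_conv_nth)
    then have jn: "j < n" and bj: "b = col P j" using kn by (auto simp: colP L_def k_def nth_append)
    have "Q *\<^sub>v b = col (Q * P) j" unfolding bj using Q(1) P jn by (intro col_mult2[symmetric]) auto
    then have "Q *\<^sub>v b = unit_vec n j" using Q jn by simp
    then show "b \<in> K" using j b Bc by (auto simp: K_def)
  qed
  ultimately have "span B \<subseteq> K"
    using span_is_subset[of B K] by (simp add: VectorSpace.subspace_def)
  then have WK: "W \<subseteq> K" using WB by blast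
  show ?thesis
  proof (rule that[OF kn P Q colW])
    show "(Q *\<^sub>v w) $ i = 0" if "w \<in> W" "k \<le> i" "i < n" for w i
      using that WK by (auto simp: K_def)
    show "W = {0\<^sub>v n}" if "k = 0"
    proof -
      have "B = {}" using that bs by (simp add: k_def)
      then have "W \<subseteq> {0\<^sub>v n}" using WB span_empty by auto
      moreover have "0\<^sub>v n \<in> W" using sub unfolding submodule_def by (simp add: module_vec_simps)
      ultimately show ?thesis by blast
    qed
    show "W = carrier_vec n" if "k = n"
    proof -
      have "card B = n" using that bs distinct_card by (metis k_def)
      then have "B = A" using BA A(1) cardA by (simp add: card_subset_eq)
      then have "span B = carrier_vec n" using bas by (simp add: basis_def)
      then show ?thesis using Wc BspW by blast
    qed
  qed
qed

text \<open>
  A span over finite subsets, because the finiteness of \<open>Irr G\<close> is a consequence of the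
  results about it.
\<close>

definition irr_span :: "('a, 'b) monoid_scheme \<Rightarrow> ('a \<Rightarrow> complex) set" where
  "irr_span G = {\<lambda>g. \<Sum>\<xi>\<in>F. c \<xi> * \<xi> g | F c. finite F \<and> F \<subseteq> Irr G}"

lemma irr_span_Irr: "\<xi> \<in> Irr G \<Longrightarrow> \<xi> \<in> irr_span G"
  unfolding irr_span_def
  by (rule CollectI, rule exI[of _ "{\<xi>}"], rule exI[of _ "\<lambda>_. 1"]) simp

lemma irr_span_zero: "(\<lambda>_. 0) \<in> irr_span G"
  unfolding irr_span_def
  by (rule CollectI, rule exI[of _ "{}"], rule exI[of _ "\<lambda>_. 1"]) simp

lemma irr_span_add:
  assumes "\<alpha> \<in> irr_span G" "\<beta> \<in> irr_span G"
  shows "(\<lambda>g. \<alpha> g + \<beta> g) \<in> irr_span G"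
proof -
  obtain F c where F: "finite F" "F \<subseteq> Irr G" "\<alpha> = (\<lambda>g. \<Sum>\<xi>\<in>F. c \<xi> * \<xi> g)"
    using assms(1) by (auto simp: irr_span_def)
  obtain F' c' where F': "finite F'" "F' \<subseteq> Irr G" "\<beta> = (\<lambda>g. \<Sum>\<xi>\<in>F'. c' \<xi> * \<xi> g)"
    using assms(2) by (auto simp: irr_span_def)
  let ?d = "\<lambda>\<xi>. (if \<xi> \<in> F then c \<xi> else 0) + (if \<xi> \<in> F' then c' \<xi> else 0)"
  have "\<alpha> g = (\<Sum>\<xi>\<in>F \<union> F'. (if \<xi> \<in> F then c \<xi> else 0) * \<xi> g)" for g
    unfolding F(3) by (rule sum.mono_neutral_cong_left) (use F F' in auto)
  moreover have "\<beta> g = (\<Sum>\<xi>\<in>F \<union> F'. (if \<xi> \<in> F' then c' \<xi> else 0) * \<xi> g)" for g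
    unfolding F'(3) by (rule sum.mono_neutral_cong_left) (use F F' in auto)
  ultimately have "(\<lambda>g. \<alpha> g + \<beta> g) = (\<lambda>g. \<Sum>\<xi>\<in>F \<union> F'. ?d \<xi> * \<xi> g)"
    by (simp add: distrib_right sum.distrib)
  then show ?thesis
    unfolding irr_span_def using F F' by (intro CollectI exI[of _ "F \<union> F'"] exI[of _ ?d]) auto
qed

text \<open>
  A representation of positive degree that is not irreducible has a proper nonzero invariant
  subspace. In an adapted basis its matrices are block triangular, so the two diagonal blocks
  are representations of smaller degree whose traces add up to the given character.
\<close>

lemma rep_character_in_irr_span:
  assumes G: "group G" and "\<rho> \<in> hom G (GL n)"
  shows "rep_character G n \<rho> \<in> irr_span G"
  using assms(2)
proof (induction n arbitrary: \<rho> rule: less_induct)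
  case (less n)
  have car: "\<rho> g \<in> carrier_mat n n" if "g \<in> carrier G" for g
    using less.prems that by (simp add: hom_GL_iff[OF G])
  have mult: "\<rho> (g \<otimes>\<^bsub>G\<^esub> h) = \<rho> g * \<rho> h" if "g \<in> carrier G" "h \<in> carrier G" for g h
    using less.prems that by (simp add: hom_GL_iff[OF G])
  have one: "\<rho> \<one>\<^bsub>G\<^esub> = 1\<^sub>m n"
    using less.prems by (simp add: hom_GL_iff[OF G])
  interpret group G by (rule G)
  consider "n = 0" | "irreducible_rep G n \<rho>" | "n > 0" "\<not> irreducible_rep G n \<rho>" by blast
  then show ?case
  proof cases
    case 1
    then show ?thesis using irr_span_zero[of G] by (simp add: rep_character_def cong: if_cong)
  next
    case 2
    then have "rep_character G n \<rho> \<in> Irr G" unfolding Irr_def by blast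
    then show ?thesis by (rule irr_span_Irr)
  next
    case 3
    then obtain W where W: "VectorSpace.subspace class_ring W (module_vec TYPE(complex) n)"
      and inv: "\<And>g w. g \<in> carrier G \<Longrightarrow> w \<in> W \<Longrightarrow> \<rho> g *\<^sub>v w \<in> W"
      and proper: "W \<noteq> {0\<^sub>v n}" "W \<noteq> carrier_vec n"
      using less.prems unfolding irreducible_rep_def by blast
    obtain k P Q where kn: "k \<le> n" and P: "P \<in> carrier_mat n n" and Q: "Q \<in> carrier_mat n n"
      and PQ: "P * Q = 1\<^sub>m n" and QP: "Q * P = 1\<^sub>m n"
      and colW: "\<And>j. j < k \<Longrightarrow> col P j \<in> W"
      and QW: "\<And>w i. w \<in> W \<Longrightarrow> k \<le> i \<Longrightarrow> i < n \<Longrightarrow> (Q *\<^sub>v w) $ i = 0"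
      and k0: "k = 0 \<Longrightarrow> W = {0\<^sub>v n}" and k1: "k = n \<Longrightarrow> W = carrier_vec n"
      by (rule adapted_basis[OF W]) (rule that)
    have "k \<noteq> 0" "k \<noteq> n" using k0 k1 proper by blast+
    then have k: "0 < k" "k < n" using kn by simp_all
    \<comment> \<open>The representation in the adapted basis; its lower left block vanishes.\<close>
    define R where "R g = Q * \<rho> g * P" for g
    have R: "R g \<in> carrier_mat n n" if "g \<in> carrier G" for g
      using car[OF that] P Q by (simp add: R_def)
    have Rmult: "R (g \<otimes>\<^bsub>G\<^esub> h) = R g * R h" if gh: "g \<in> carrier G" "h \<in> carrier G" for g h
    proof -
      have "R g * R h = Q * \<rho> g * (P * Q) * \<rho> h * P"
        using car[OF gh(1)] car[OF gh(2)] P Q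
        by (simp add: R_def assoc_mult_mat[of _ n n _ n _ n])
      also have "\<dots> = R (g \<otimes>\<^bsub>G\<^esub> h)"
        using car[OF gh(1)] car[OF gh(2)] P Q
        by (simp add: PQ R_def mult[OF gh] assoc_mult_mat[of _ n n _ n _ n])
      finally show ?thesis by simp
    qed
    have Rone: "R \<one>\<^bsub>G\<^esub> = 1\<^sub>m n" using P Q QP by (simp add: R_def one)
    have Rzero: "R g $$ (i, j) = 0" if g: "g \<in> carrier G" and ij: "k \<le> i" "i < n" "j < k" for g i j
    proof -
      have "R g = Q * (\<rho> g * P)" using car[OF g] P Q by (simp add: R_def)
      moreover have j: "j < n" using ij k by simp
      ultimately have "col (R g) j = Q *\<^sub>v (\<rho> g *\<^sub>v col P j)"
        using col_mult2[OF Q mult_carrier_mat[OF car[OF g] P] j] col_mult2[OF car[OF g] P j]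
        by (simp only:)
      moreover have "(Q *\<^sub>v (\<rho> g *\<^sub>v col P j)) $ i = 0"
        using QW[OF inv[OF g colW[OF ij(3)]] ij(1,2)] .
      moreover have "R g $$ (i, j) = col (R g) j $ i" using R[OF g] ij k by simp
      ultimately show ?thesis by simp
    qed
    have Rentry: "R (g \<otimes>\<^bsub>G\<^esub> h) $$ (i, j) = (\<Sum>l<n. R g $$ (i, l) * R h $$ (l, j))"
      if "g \<in> carrier G" "h \<in> carrier G" "i < n" "j < n" for g h i j
      using Rmult[OF that(1,2)] R[OF that(1)] R[OF that(2)] that(3,4)
      by (simp add: scalar_prod_def lessThan_atLeast0)
    define \<rho>1 where "\<rho>1 g = mat k k (\<lambda>(i, j). R g $$ (i, j))" for g
    define \<rho>2 where "\<rho>2 g = mat (n - k) (n - k) (\<lambda>(i, j). R g $$ (k + i, k + j))" for g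
    have sum_split: "(\<Sum>l<n. f l) = (\<Sum>l<k. f l) + (\<Sum>l<n - k. f (k + l))" for f :: "nat \<Rightarrow> complex"
    proof -
      have "(\<Sum>l<n. f l) = (\<Sum>l\<in>{..<k} \<union> {k..<n}. f l)"
        using k by (intro sum.cong) auto
      also have "\<dots> = (\<Sum>l<k. f l) + (\<Sum>l\<in>{k..<n}. f l)"
        by (rule sum.union_disjoint) auto
      also have "(\<Sum>l\<in>{k..<n}. f l) = (\<Sum>l<n - k. f (k + l))"
        by (rule sum.reindex_bij_witness[of _ "\<lambda>l. k + l" "\<lambda>l. l - k"]) auto
      finally show ?thesis .
    qed
    have "\<rho>1 \<in> hom G (GL k)"
    proof (unfold hom_GL_iff[OF G], intro conjI ballI)
      show "\<rho>1 g \<in> carrier_mat k k" for g by (simp add: \<rho>1_def)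
      show "\<rho>1 \<one>\<^bsub>G\<^esub> = 1\<^sub>m k" using k by (auto simp: \<rho>1_def Rone intro!: eq_matI)
      fix g h assume gh: "g \<in> carrier G" "h \<in> carrier G"
      show "\<rho>1 (g \<otimes>\<^bsub>G\<^esub> h) = \<rho>1 g * \<rho>1 h"
      proof (rule eq_matI)
        fix i j assume "i < dim_row (\<rho>1 g * \<rho>1 h)" "j < dim_col (\<rho>1 g * \<rho>1 h)"
        then have ij: "i < k" "j < k" by (auto simp: \<rho>1_def)
        then show "\<rho>1 (g \<otimes>\<^bsub>G\<^esub> h) $$ (i, j) = (\<rho>1 g * \<rho>1 h) $$ (i, j)"
          using k Rentry[OF gh, of i j] Rzero[OF gh(2) _ _ ij(2)]
          by (simp add: \<rho>1_def sum_split scalar_prod_def atLeast0LessThan)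
      qed (auto simp: \<rho>1_def)
    qed
    moreover have "\<rho>2 \<in> hom G (GL (n - k))"
    proof (unfold hom_GL_iff[OF G], intro conjI ballI)
      show "\<rho>2 g \<in> carrier_mat (n - k) (n - k)" for g by (simp add: \<rho>2_def)
      show "\<rho>2 \<one>\<^bsub>G\<^esub> = 1\<^sub>m (n - k)" using k by (auto simp: \<rho>2_def Rone intro!: eq_matI)
      fix g h assume gh: "g \<in> carrier G" "h \<in> carrier G"
      show "\<rho>2 (g \<otimes>\<^bsub>G\<^esub> h) = \<rho>2 g * \<rho>2 h"
      proof (rule eq_matI)
        fix i j assume "i < dim_row (\<rho>2 g * \<rho>2 h)" "j < dim_col (\<rho>2 g * \<rho>2 h)"
        then have ij: "i < n - k" "j < n - k" by (auto simp: \<rho>2_def)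
        then show "\<rho>2 (g \<otimes>\<^bsub>G\<^esub> h) $$ (i, j) = (\<rho>2 g * \<rho>2 h) $$ (i, j)"
          using k Rentry[OF gh, of "k + i" "k + j"] Rzero[OF gh(1), of "k + i"]
          by (simp add: \<rho>2_def sum_split scalar_prod_def atLeast0LessThan)
      qed (auto simp: \<rho>2_def)
    qed
    ultimately have "(\<lambda>g. rep_character G k \<rho>1 g + rep_character G (n - k) \<rho>2 g) \<in> irr_span G"
      using less.IH[of k \<rho>1] less.IH[of "n - k" \<rho>2] k by (intro irr_span_add) auto
    moreover have "rep_character G n \<rho> g = rep_character G k \<rho>1 g + rep_character G (n - k) \<rho>2 g" for g
    proof (cases "g \<in> carrier G")
      case True
      have "(\<Sum>i<n. \<rho> g $$ (i, i)) = (\<Sum>i<n. R g $$ (i, i))"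
      proof -
        have "\<rho> g * P * Q = \<rho> g"
          using car[OF True] P Q PQ by (simp add: assoc_mult_mat[of _ n n _ n _ n])
        moreover have "Q * (\<rho> g * P) = R g"
          using car[OF True] P Q by (simp add: R_def assoc_mult_mat[of _ n n _ n _ n])
        ultimately show ?thesis
          using trace_mult_commute[of "\<rho> g * P" n n Q] car[OF True] P Q by simp
      qed
      then show ?thesis using True by (simp add: rep_character_def sum_split \<rho>1_def \<rho>2_def)
    qed (simp add: rep_character_def)
    ultimately show ?thesis by presburger
  qed
qed

section \<open>Orthogonality of matrix coefficients\<close>

text \<open>
  Formed entrywise, so that the shape is fixed even when the index set is empty.
\<close>

definition mat_sum :: "nat \<Rightarrow> nat \<Rightarrow> ('i \<Rightarrow> complex mat) \<Rightarrow> 'i set \<Rightarrow> complex mat" where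
  "mat_sum n m f A = mat n m (\<lambda>ij. \<Sum>x\<in>A. f x $$ ij)"

lemma mat_sum_carrier [simp]: "mat_sum n m f A \<in> carrier_mat n m"
  by (simp add: mat_sum_def)

lemma mat_sum_index [simp]:
  "i < n \<Longrightarrow> j < m \<Longrightarrow> mat_sum n m f A $$ (i, j) = (\<Sum>x\<in>A. f x $$ (i, j))"
  by (simp add: mat_sum_def)

lemma mat_mult_index_sum:
  fixes A B :: "complex mat"
  assumes "A \<in> carrier_mat n m" "B \<in> carrier_mat m k" "i < n" "j < k"
  shows "(A * B) $$ (i, j) = (\<Sum>l<m. A $$ (i, l) * B $$ (l, j))"
  using assms by (auto simp: scalar_prod_def atLeast0LessThan)

lemma mult_mat_sum:
  assumes B: "B \<in> carrier_mat k n" and f: "\<And>x. x \<in> A \<Longrightarrow> f x \<in> carrier_mat n m"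
  shows "B * mat_sum n m f A = mat_sum k m (\<lambda>x. B * f x) A"
proof (rule eq_matI)
  fix i j assume "i < dim_row (mat_sum k m (\<lambda>x. B * f x) A)" "j < dim_col (mat_sum k m (\<lambda>x. B * f x) A)"
  then have ij: "i < k" "j < m" by (simp_all add: mat_sum_def)
  have "(B * mat_sum n m f A) $$ (i, j) = (\<Sum>l<n. B $$ (i, l) * (\<Sum>x\<in>A. f x $$ (l, j)))"
    using ij by (simp add: mat_mult_index_sum[OF B mat_sum_carrier ij])
  also have "\<dots> = (\<Sum>x\<in>A. \<Sum>l<n. B $$ (i, l) * f x $$ (l, j))"
    unfolding sum_distrib_left by (rule sum.swap)
  also have "\<dots> = (\<Sum>x\<in>A. (B * f x) $$ (i, j))"
    by (intro sum.cong refl mat_mult_index_sum[OF B f ij, symmetric])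
  finally show "(B * mat_sum n m f A) $$ (i, j) = mat_sum k m (\<lambda>x. B * f x) A $$ (i, j)"
    using ij by simp
qed (use B in \<open>auto simp: mat_sum_def\<close>)

lemma mat_sum_mult:
  assumes B: "B \<in> carrier_mat m k" and f: "\<And>x. x \<in> A \<Longrightarrow> f x \<in> carrier_mat n m"
  shows "mat_sum n m f A * B = mat_sum n k (\<lambda>x. f x * B) A"
proof (rule eq_matI)
  fix i j assume "i < dim_row (mat_sum n k (\<lambda>x. f x * B) A)" "j < dim_col (mat_sum n k (\<lambda>x. f x * B) A)"
  then have ij: "i < n" "j < k" by (simp_all add: mat_sum_def)
  have "(mat_sum n m f A * B) $$ (i, j) = (\<Sum>l<m. (\<Sum>x\<in>A. f x $$ (i, l)) * B $$ (l, j))"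
    using ij by (simp add: mat_mult_index_sum[OF mat_sum_carrier B ij])
  also have "\<dots> = (\<Sum>x\<in>A. \<Sum>l<m. f x $$ (i, l) * B $$ (l, j))"
    unfolding sum_distrib_right by (rule sum.swap)
  also have "\<dots> = (\<Sum>x\<in>A. (f x * B) $$ (i, j))"
    by (intro sum.cong refl mat_mult_index_sum[OF f B ij, symmetric])
  finally show "(mat_sum n m f A * B) $$ (i, j) = mat_sum n k (\<lambda>x. f x * B) A $$ (i, j)"
    using ij by simp
qed (use B in \<open>auto simp: mat_sum_def\<close>)

lemma mat_sum_reindex:
  assumes "bij_betw h A B" "\<And>x. x \<in> A \<Longrightarrow> f x = f' (h x)"
  shows "mat_sum n m f A = mat_sum n m f' B"
proof -
  have "(\<Sum>x\<in>A. f x $$ ij) = (\<Sum>y\<in>B. f' y $$ ij)" for ij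
    using assms by (simp add: sum.reindex_bij_betw[OF assms(1), symmetric])
  then show ?thesis by (simp add: mat_sum_def)
qed

locale finite_group = group G for G (structure) +
  assumes finite_carrier: "finite (carrier G)"
begin

lemma bij_mult_left: "a \<in> carrier G \<Longrightarrow> bij_betw (\<lambda>x. a \<otimes> x) (carrier G) (carrier G)"
  by (rule bij_betw_byWitness[of _ "\<lambda>x. inv a \<otimes> x"]) (auto simp flip: m_assoc)

lemma bij_mult_right: "a \<in> carrier G \<Longrightarrow> bij_betw (\<lambda>x. x \<otimes> a) (carrier G) (carrier G)"
  by (rule bij_betw_byWitness[of _ "\<lambda>x. x \<otimes> inv a"]) (auto simp: m_assoc)

lemma bij_conjugation: "a \<in> carrier G \<Longrightarrow> bij_betw (\<lambda>x. a \<otimes> x \<otimes> inv a) (carrier G) (carrier G)"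
  using bij_betw_trans[OF bij_mult_left[of a] bij_mult_right[of "inv a"]] by (simp add: comp_def)

lemma card_nz: "of_nat (card (carrier G)) \<noteq> (0::complex)"
  using finite_carrier by auto

lemma irreducible_repD:
  assumes "irreducible_rep G n \<rho>"
  shows "n > 0" "g \<in> carrier G \<Longrightarrow> \<rho> g \<in> carrier_mat n n"
    "g \<in> carrier G \<Longrightarrow> h \<in> carrier G \<Longrightarrow> \<rho> (g \<otimes> h) = \<rho> g * \<rho> h"
    "\<rho> \<one> = 1\<^sub>m n"
  using assms hom_GL_iff[OF is_group, of \<rho> n] unfolding irreducible_rep_def by auto

lemma rep_character_one: "irreducible_rep G n \<rho> \<Longrightarrow> rep_character G n \<rho> \<one> = of_nat n"
  by (simp add: rep_character_def irreducible_repD(4))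

lemma Irr_one_ne_zero: "\<xi> \<in> Irr G \<Longrightarrow> \<xi> \<one> \<noteq> 0"
  by (auto simp: Irr_def rep_character_one dest: irreducible_repD(1))

lemma Irr_one_pos_nat: "\<xi> \<in> Irr G \<Longrightarrow> \<exists>n>0. \<xi> \<one> = of_nat n"
  by (auto simp: Irr_def rep_character_one dest: irreducible_repD(1))

lemma Irr_outside: "\<xi> \<in> Irr G \<Longrightarrow> g \<notin> carrier G \<Longrightarrow> \<xi> g = 0"
  by (auto simp: Irr_def rep_character_def)

text \<open>
  The sum over the group, without division by its order: what matters is that it is an
  intertwiner.
\<close>

definition average :: "nat \<Rightarrow> nat \<Rightarrow> ('a \<Rightarrow> complex mat) \<Rightarrow> ('a \<Rightarrow> complex mat) \<Rightarrow> complex mat \<Rightarrow> complex mat" where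
  "average n m \<rho> \<tau> T = mat_sum n m (\<lambda>x. \<rho> x * T * \<tau> (inv x)) (carrier G)"

lemma average_carrier [simp]: "average n m \<rho> \<tau> T \<in> carrier_mat n m"
  by (simp add: average_def)

text \<open>
  Translating the summation variable by \<open>g\<close> moves \<open>\<rho>(g)\<close> from the left to \<open>\<tau>(g)\<close> on the right.
\<close>

lemma average_intertwines:
  assumes \<rho>: "irreducible_rep G n \<rho>" and \<tau>: "irreducible_rep G m \<tau>"
    and T: "T \<in> carrier_mat n m" and g: "g \<in> carrier G"
  shows "\<rho> g * average n m \<rho> \<tau> T = average n m \<rho> \<tau> T * \<tau> g"
proof -
  note rc = irreducible_repD(2)[OF \<rho>] and tc = irreducible_repD(2)[OF \<tau>]
  have sc: "\<rho> x * T * \<tau> (inv x) \<in> carrier_mat n m" if "x \<in> carrier G" for x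
    using rc[OF that] tc[of "inv x"] that T by auto
  have "\<rho> g * average n m \<rho> \<tau> T = mat_sum n m (\<lambda>x. \<rho> g * (\<rho> x * T * \<tau> (inv x))) (carrier G)"
    unfolding average_def by (rule mult_mat_sum[OF rc[OF g] sc])
  also have "\<dots> = mat_sum n m (\<lambda>x. \<rho> x * T * \<tau> (inv x) * \<tau> g) (carrier G)"
  proof (rule mat_sum_reindex[OF bij_mult_left[OF g]])
    fix x assume x: "x \<in> carrier G"
    have "\<rho> (g \<otimes> x) * T * \<tau> (inv (g \<otimes> x)) * \<tau> g = \<rho> (g \<otimes> x) * T * (\<tau> (inv (g \<otimes> x)) * \<tau> g)"
      using rc[of "g \<otimes> x"] tc[of "inv (g \<otimes> x)"] tc[OF g] g x T
      by (intro assoc_mult_mat[of _ n m _ m _ m]) auto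
    also have "\<tau> (inv (g \<otimes> x)) * \<tau> g = \<tau> (inv (g \<otimes> x) \<otimes> g)"
      using irreducible_repD(3)[OF \<tau>] g x by simp
    also have "inv (g \<otimes> x) \<otimes> g = inv x"
      using g x by (simp add: inv_mult_group m_assoc)
    also have "\<rho> (g \<otimes> x) = \<rho> g * \<rho> x"
      using irreducible_repD(3)[OF \<rho>] g x by simp
    also have "\<rho> g * \<rho> x * T * \<tau> (inv x) = \<rho> g * (\<rho> x * T * \<tau> (inv x))"
      using rc[OF g] rc[OF x] tc[of "inv x"] x T
      by (simp add: assoc_mult_mat[of _ n n _ n _ m] assoc_mult_mat[of _ n n _ m _ m] assoc_mult_mat[of _ n m _ m _ m])
    finally show "\<rho> g * (\<rho> x * T * \<tau> (inv x)) = \<rho> (g \<otimes> x) * T * \<tau> (inv (g \<otimes> x)) * \<tau> g"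
      by (simp only: irreducible_repD(3)[OF \<rho> g x])
  qed
  also have "\<dots> = average n m \<rho> \<tau> T * \<tau> g"
    unfolding average_def by (rule mat_sum_mult[OF tc[OF g] sc, symmetric])
  finally show ?thesis .
qed

text \<open>
  An invertible intertwiner would make the traces of \<open>\<rho>(g)\<close> and \<open>\<tau>(g)\<close> equal for every \<open>g\<close>.
\<close>

lemma average_eq_zero:
  assumes \<rho>: "irreducible_rep G n \<rho>" and \<tau>: "irreducible_rep G m \<tau>"
    and ne: "rep_character G n \<rho> \<noteq> rep_character G m \<tau>"
    and T: "T \<in> carrier_mat n m"
  shows "average n m \<rho> \<tau> T = 0\<^sub>m n m"
proof (rule ccontr)
  let ?A = "average n m \<rho> \<tau> T"
  assume "\<not> ?thesis"
  with schur_intertwiner[OF is_group \<rho> \<tau> average_carrier average_intertwines[OF \<rho> \<tau> T]]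
  obtain B where B: "B \<in> carrier_mat m n" "?A * B = 1\<^sub>m n" "B * ?A = 1\<^sub>m m" by blast
  have "(\<Sum>i<n. \<rho> g $$ (i, i)) = (\<Sum>i<m. \<tau> g $$ (i, i))" if g: "g \<in> carrier G" for g
  proof -
    have rc: "\<rho> g \<in> carrier_mat n n" and tc: "\<tau> g \<in> carrier_mat m m"
      using irreducible_repD(2)[OF \<rho> g] irreducible_repD(2)[OF \<tau> g] .
    have "\<rho> g = \<rho> g * (?A * B)" using rc B by simp
    also have "\<dots> = \<rho> g * ?A * B" using rc B by (simp add: assoc_mult_mat[of _ n n _ m _ n])
    also have "\<dots> = ?A * \<tau> g * B" using average_intertwines[OF \<rho> \<tau> T g] by simp
    also have "\<dots> = ?A * (\<tau> g * B)" using tc B by (simp add: assoc_mult_mat[of _ n m _ m _ n])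
    finally have 1: "\<rho> g = ?A * (\<tau> g * B)" .
    have "\<tau> g * B * ?A = \<tau> g * (B * ?A)"
      using tc B by (intro assoc_mult_mat[of _ m m _ n _ m]) auto
    then have 2: "\<tau> g * B * ?A = \<tau> g" using tc B by simp
    have "(\<Sum>i<n. (?A * (\<tau> g * B)) $$ (i, i)) = (\<Sum>j<m. (\<tau> g * B * ?A) $$ (j, j))"
      using tc B by (intro trace_mult_commute) auto
    then show ?thesis unfolding 2 1[symmetric] .
  qed
  then have "rep_character G n \<rho> = rep_character G m \<tau>"
    by (auto simp: rep_character_def)
  then show False using ne by contradiction
qed

definition unit_mat :: "nat \<Rightarrow> nat \<Rightarrow> nat \<Rightarrow> nat \<Rightarrow> complex mat" where
  "unit_mat n m k j = mat n m (\<lambda>(a, b). if a = k \<and> b = j then 1 else 0)"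

text \<open>
  Averaging a matrix unit turns the statements about intertwiners into relations between
  matrix coefficients.
\<close>

lemma average_unit_mat:
  assumes \<rho>: "irreducible_rep G n \<rho>" and \<tau>: "irreducible_rep G m \<tau>"
    and "i < n" "k < n" "j < m" "l < m"
  shows "average n m \<rho> \<tau> (unit_mat n m k j) $$ (i, l) =
    (\<Sum>x\<in>carrier G. \<rho> x $$ (i, k) * \<tau> (inv x) $$ (j, l))"
proof -
  have U: "unit_mat n m k j \<in> carrier_mat n m" by (simp add: unit_mat_def)
  have "(\<rho> x * unit_mat n m k j * \<tau> (inv x)) $$ (i, l) = \<rho> x $$ (i, k) * \<tau> (inv x) $$ (j, l)"
    if x: "x \<in> carrier G" for x
  proof -
    have rc: "\<rho> x \<in> carrier_mat n n" and tc: "\<tau> (inv x) \<in> carrier_mat m m"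
      using irreducible_repD(2)[OF \<rho> x] irreducible_repD(2)[OF \<tau>, of "inv x"] x by simp_all
    have e: "(\<rho> x * unit_mat n m k j) $$ (i, b) = (if b = j then \<rho> x $$ (i, k) else 0)" if "b < m" for b
    proof -
      have "(\<rho> x * unit_mat n m k j) $$ (i, b) = (\<Sum>a<n. \<rho> x $$ (i, a) * unit_mat n m k j $$ (a, b))"
        by (rule mat_mult_index_sum[OF rc U \<open>i < n\<close> that])
      also have "\<dots> = (\<Sum>a<n. if a = k then (if b = j then \<rho> x $$ (i, k) else 0) else 0)"
        using that by (intro sum.cong) (auto simp: unit_mat_def)
      finally show ?thesis using \<open>k < n\<close> by simp
    qed
    have "(\<rho> x * unit_mat n m k j * \<tau> (inv x)) $$ (i, l)
      = (\<Sum>b<m. (\<rho> x * unit_mat n m k j) $$ (i, b) * \<tau> (inv x) $$ (b, l))"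
      by (rule mat_mult_index_sum[OF mult_carrier_mat[OF rc U] tc \<open>i < n\<close> \<open>l < m\<close>])
    also have "\<dots> = (\<Sum>b<m. if b = j then \<rho> x $$ (i, k) * \<tau> (inv x) $$ (j, l) else 0)"
      by (intro sum.cong) (auto simp: e)
    finally show ?thesis using \<open>j < m\<close> by simp
  qed
  then show ?thesis using assms by (simp add: average_def)
qed

lemma coefficients_orthogonal:
  assumes \<rho>: "irreducible_rep G n \<rho>" and \<tau>: "irreducible_rep G m \<tau>"
    and ne: "rep_character G n \<rho> \<noteq> rep_character G m \<tau>"
    and "i < n" "k < n" "j < m" "l < m"
  shows "(\<Sum>x\<in>carrier G. \<rho> x $$ (i, k) * \<tau> (inv x) $$ (j, l)) = 0"
proof -
  have "unit_mat n m k j \<in> carrier_mat n m" by (simp add: unit_mat_def)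
  from average_eq_zero[OF \<rho> \<tau> ne this]
  show ?thesis using average_unit_mat[OF \<rho> \<tau> assms(4-7)] assms(4-7) by simp
qed

text \<open>
  The average of a matrix unit is a scalar matrix by Schur's lemma; its trace is that of the
  matrix unit times \<open>|G|\<close>, which determines the scalar.
\<close>

lemma coefficients_self:
  assumes \<rho>: "irreducible_rep G n \<rho>" and ik: "i < n" "k < n" "j < n" "l < n"
  shows "(\<Sum>x\<in>carrier G. \<rho> x $$ (i, k) * \<rho> (inv x) $$ (j, l)) =
    (if i = l \<and> k = j then of_nat (card (carrier G)) / of_nat n else 0)"
proof -
  have "unit_mat n n k j \<in> carrier_mat n n" by (simp add: unit_mat_def)
  from schur_scalar[OF is_group \<rho> average_carrier average_intertwines[OF \<rho> \<rho> this]]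
  obtain c where c: "average n n \<rho> \<rho> (unit_mat n n k j) = c \<cdot>\<^sub>m 1\<^sub>m n" by blast
  have entry: "(\<Sum>x\<in>carrier G. \<rho> x $$ (i, k) * \<rho> (inv x) $$ (j, l)) = (if i = l then c else 0)"
    if "i < n" "l < n" for i l
    using average_unit_mat[OF \<rho> \<rho> that(1) ik(2,3) that(2)] that by (auto simp: c)
  have "of_nat n * c = (\<Sum>i<n. \<Sum>x\<in>carrier G. \<rho> x $$ (i, k) * \<rho> (inv x) $$ (j, i))"
    by (simp add: entry)
  also have "\<dots> = (\<Sum>x\<in>carrier G. \<Sum>i<n. \<rho> (inv x) $$ (j, i) * \<rho> x $$ (i, k))"
    by (subst sum.swap) (simp add: mult.commute)
  also have "\<dots> = (\<Sum>x\<in>carrier G. if k = j then 1 else 0)"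
  proof (rule sum.cong)
    fix x assume x: "x \<in> carrier G"
    have "(\<Sum>i<n. \<rho> (inv x) $$ (j, i) * \<rho> x $$ (i, k)) = (\<rho> (inv x) * \<rho> x) $$ (j, k)"
      using x ik irreducible_repD(2)[OF \<rho>] by (intro mat_mult_index_sum[symmetric]) auto
    also have "\<rho> (inv x) * \<rho> x = 1\<^sub>m n"
      using x irreducible_repD(3)[OF \<rho>, of "inv x" x] irreducible_repD(4)[OF \<rho>] by simp
    finally show "(\<Sum>i<n. \<rho> (inv x) $$ (j, i) * \<rho> x $$ (i, k)) = (if k = j then 1 else 0)"
      using ik by simp
  qed simp
  finally have "of_nat n * c = (if k = j then of_nat (card (carrier G)) else 0)" by simp
  then have "c = (if k = j then of_nat (card (carrier G)) / of_nat n else 0)"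
    using irreducible_repD(1)[OF \<rho>] by (auto simp: field_simps)
  then show ?thesis using entry[OF ik(1,4)] by simp
qed

lemma convolution_rep_characters:
  assumes \<rho>: "irreducible_rep G n \<rho>" and \<tau>: "irreducible_rep G m \<tau>" and g: "g \<in> carrier G"
  shows "convolution G (rep_character G n \<rho>) (rep_character G m \<tau>) g =
    (\<Sum>i<n. \<Sum>k<n. \<Sum>j<m. \<rho> g $$ (k, i) *
      (\<Sum>x\<in>carrier G. \<rho> x $$ (i, k) * \<tau> (inv x) $$ (j, j))) / of_nat (card (carrier G))"
proof -
  have "rep_character G n \<rho> (x \<otimes> g) * rep_character G m \<tau> (inv x) =
    (\<Sum>i<n. \<Sum>k<n. \<Sum>j<m. \<rho> g $$ (k, i) * (\<rho> x $$ (i, k) * \<tau> (inv x) $$ (j, j)))"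
    if x: "x \<in> carrier G" for x
  proof -
    have "rep_character G n \<rho> (x \<otimes> g) = (\<Sum>i<n. \<Sum>k<n. \<rho> x $$ (i, k) * \<rho> g $$ (k, i))"
      using x g irreducible_repD(3)[OF \<rho> x g] mat_mult_index_sum[OF irreducible_repD(2)[OF \<rho> x] irreducible_repD(2)[OF \<rho> g]]
      by (simp add: rep_character_def)
    then show ?thesis using x
      by (simp add: rep_character_def sum_product sum_distrib_left sum_distrib_right mult_ac)
  qed
  then have "(\<Sum>x\<in>carrier G. rep_character G n \<rho> (x \<otimes> g) * rep_character G m \<tau> (inv x)) =
    (\<Sum>x\<in>carrier G. \<Sum>i<n. \<Sum>k<n. \<Sum>j<m. \<rho> g $$ (k, i) * (\<rho> x $$ (i, k) * \<tau> (inv x) $$ (j, j)))"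
    by simp
  also have "\<dots> = (\<Sum>i<n. \<Sum>x\<in>carrier G. \<Sum>k<n. \<Sum>j<m. \<rho> g $$ (k, i) * (\<rho> x $$ (i, k) * \<tau> (inv x) $$ (j, j)))"
    by (rule sum.swap)
  also have "\<dots> = (\<Sum>i<n. \<Sum>k<n. \<Sum>x\<in>carrier G. \<Sum>j<m. \<rho> g $$ (k, i) * (\<rho> x $$ (i, k) * \<tau> (inv x) $$ (j, j)))"
    by (intro sum.cong refl sum.swap)
  also have "\<dots> = (\<Sum>i<n. \<Sum>k<n. \<Sum>j<m. \<Sum>x\<in>carrier G. \<rho> g $$ (k, i) * (\<rho> x $$ (i, k) * \<tau> (inv x) $$ (j, j)))"
    by (intro sum.cong refl sum.swap)
  finally show ?thesis using g by (simp add: convolution_def sum_distrib_left)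
qed

text \<open>
  The orthogonality relation for characters in convolution form: the \<open>\<xi>(1) \<xi>\<close> are orthogonal
  idempotents.
\<close>

lemma convolution_Irr:
  assumes "\<xi> \<in> Irr G" "\<psi> \<in> Irr G"
  shows "convolution G \<xi> \<psi> = (\<lambda>g. if \<xi> = \<psi> then \<xi> g / \<xi> \<one> else 0)"
proof
  fix g
  obtain n \<rho> where \<rho>: "irreducible_rep G n \<rho>" and x: "\<xi> = rep_character G n \<rho>"
    using assms(1) by (auto simp: Irr_def)
  show "convolution G \<xi> \<psi> g = (if \<xi> = \<psi> then \<xi> g / \<xi> \<one> else 0)"
  proof (cases "g \<in> carrier G")
    case g: True
    show ?thesis
    proof (cases "\<xi> = \<psi>")
      case True
      have "(\<Sum>i<n. \<Sum>k<n. \<Sum>j<n. \<rho> g $$ (k, i) *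
          (\<Sum>x\<in>carrier G. \<rho> x $$ (i, k) * \<rho> (inv x) $$ (j, j))) =
        (\<Sum>i<n. \<Sum>k<n. \<Sum>j<n. if j = i then
          (if k = i then \<rho> g $$ (i, i) * (of_nat (card (carrier G)) / of_nat n) else 0) else 0)"
        by (intro sum.cong refl) (auto simp: coefficients_self[OF \<rho>])
      also have "\<dots> = (\<Sum>i<n. \<rho> g $$ (i, i)) * (of_nat (card (carrier G)) / of_nat n)"
        by (simp add: sum_distrib_right sum_divide_distrib)
      finally have "convolution G \<xi> \<xi> g = (\<Sum>i<n. \<rho> g $$ (i, i)) / of_nat n"
        using convolution_rep_characters[OF \<rho> \<rho> g] card_nz by (simp add: x)
      moreover have "\<xi> g = (\<Sum>i<n. \<rho> g $$ (i, i))" "\<xi> \<one> = of_nat n"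
        using g rep_character_one[OF \<rho>] by (simp_all add: x rep_character_def)
      ultimately show ?thesis using True by simp
    next
      case False
      obtain m \<tau> where \<tau>: "irreducible_rep G m \<tau>" and y: "\<psi> = rep_character G m \<tau>"
        using assms(2) by (auto simp: Irr_def)
      show ?thesis
        using False coefficients_orthogonal[OF \<rho> \<tau>] by (simp add: x y convolution_rep_characters[OF \<rho> \<tau> g])
    qed
  next
    case False
    then show ?thesis using Irr_outside[OF assms(1) False] by (auto simp: convolution_def)
  qed
qed

end

section \<open>Class functions and their central values\<close>

context finite_group
begin

lemma convolution_sum_left:
  "convolution G (\<lambda>g. \<Sum>i\<in>I. c i * f i g) \<beta> = (\<lambda>g. \<Sum>i\<in>I. c i * convolution G (f i) \<beta> g)"
proof
  fix g
  have "(\<Sum>x\<in>carrier G. (\<Sum>i\<in>I. c i * f i (x \<otimes> g)) * \<beta> (inv x)) =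
    (\<Sum>i\<in>I. c i * (\<Sum>x\<in>carrier G. f i (x \<otimes> g) * \<beta> (inv x)))"
    unfolding sum_distrib_right sum_distrib_left mult.assoc by (rule sum.swap)
  then show "convolution G (\<lambda>g. \<Sum>i\<in>I. c i * f i g) \<beta> g = (\<Sum>i\<in>I. c i * convolution G (f i) \<beta> g)"
    by (simp add: convolution_def) (subst sum_divide_distrib, simp)
qed

lemma convolution_sum_right:
  "convolution G \<alpha> (\<lambda>g. \<Sum>i\<in>I. c i * f i g) = (\<lambda>g. \<Sum>i\<in>I. c i * convolution G \<alpha> (f i) g)"
proof
  fix g
  have "(\<Sum>x\<in>carrier G. \<alpha> (x \<otimes> g) * (\<Sum>i\<in>I. c i * f i (inv x))) =
    (\<Sum>i\<in>I. c i * (\<Sum>x\<in>carrier G. \<alpha> (x \<otimes> g) * f i (inv x)))"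
    unfolding sum_distrib_left mult.left_commute[of "\<alpha> _"] by (rule sum.swap)
  then show "convolution G \<alpha> (\<lambda>g. \<Sum>i\<in>I. c i * f i g) g = (\<Sum>i\<in>I. c i * convolution G \<alpha> (f i) g)"
    by (simp add: convolution_def) (subst sum_divide_distrib, simp)
qed

text \<open>
  The character of the regular representation, which is also the unit of convolution.
\<close>

definition convolution_one :: "'a \<Rightarrow> complex" where
  "convolution_one = (\<lambda>g. if g = \<one> then of_nat (card (carrier G)) else 0)"

lemma convolution_one_left:
  assumes "\<And>g. g \<notin> carrier G \<Longrightarrow> \<alpha> g = 0"
  shows "convolution G convolution_one \<alpha> = \<alpha>"
proof
  fix g
  show "convolution G convolution_one \<alpha> g = \<alpha> g"
  proof (cases "g \<in> carrier G")
    case g: True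
    have "(\<Sum>x\<in>carrier G. convolution_one (x \<otimes> g) * \<alpha> (inv x)) =
      (\<Sum>x\<in>carrier G. if x = inv g then of_nat (card (carrier G)) * \<alpha> g else 0)"
    proof (intro sum.cong refl)
      fix x assume x: "x \<in> carrier G"
      have "x \<otimes> g = \<one> \<longleftrightarrow> x = inv g" using x g by (metis inv_equality inv_inv l_inv)
      then show "convolution_one (x \<otimes> g) * \<alpha> (inv x) =
        (if x = inv g then of_nat (card (carrier G)) * \<alpha> g else 0)"
        using g by (simp add: convolution_one_def)
    qed
    then show ?thesis using g finite_carrier card_nz by (simp add: convolution_def)
  qed (use assms in \<open>simp add: convolution_def\<close>)
qed

lemma convolution_one_right:
  assumes "\<And>g. g \<notin> carrier G \<Longrightarrow> \<alpha> g = 0"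
  shows "convolution G \<alpha> convolution_one = \<alpha>"
proof
  fix g
  show "convolution G \<alpha> convolution_one g = \<alpha> g"
  proof (cases "g \<in> carrier G")
    case g: True
    have "(\<Sum>x\<in>carrier G. \<alpha> (x \<otimes> g) * convolution_one (inv x)) =
      (\<Sum>x\<in>carrier G. if x = \<one> then of_nat (card (carrier G)) * \<alpha> g else 0)"
    proof (intro sum.cong refl)
      fix x assume x: "x \<in> carrier G"
      have "inv x = \<one> \<longleftrightarrow> x = \<one>" using x by (metis inv_inv inv_one)
      then show "\<alpha> (x \<otimes> g) * convolution_one (inv x) =
        (if x = \<one> then of_nat (card (carrier G)) * \<alpha> g else 0)"
        using g by (simp add: convolution_one_def)
    qed
    then show ?thesis using g finite_carrier card_nz by (simp add: convolution_def)
  qed (use assms in \<open>simp add: convolution_def\<close>)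
qed

text \<open>
  The permutation matrices of left multiplication: only the identity fixes an element of \<open>G\<close>,
  and it fixes all of them.
\<close>

lemma regular_character:
  "\<exists>n \<rho>. \<rho> \<in> hom G (GL n) \<and> rep_character G n \<rho> = convolution_one"
proof -
  define n where "n = card (carrier G)"
  obtain e where e: "bij_betw e {..<n} (carrier G)"
    using ex_bij_betw_nat_finite[OF finite_carrier] by (auto simp: n_def atLeast0LessThan)
  have ec: "e i \<in> carrier G" if "i < n" for i using bij_betwE[OF e] that by simp
  have einj: "e i = e j \<longleftrightarrow> i = j" if "i < n" "j < n" for i j
    using bij_betw_imp_inj_on[OF e] that by (auto dest: inj_onD)
  define \<rho> :: "'a \<Rightarrow> complex mat"
    where "\<rho> g = mat n n (\<lambda>(i, j). if e i = g \<otimes> e j then 1 else 0)" for g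
  have car: "\<rho> g \<in> carrier_mat n n" for g by (simp add: \<rho>_def)
  have "\<rho> \<in> hom G (GL n)"
  proof (unfold hom_GL_iff[OF is_group], intro conjI ballI)
    show "\<rho> \<one> = 1\<^sub>m n" by (rule eq_matI) (auto simp: \<rho>_def ec einj)
    fix g h assume gh: "g \<in> carrier G" "h \<in> carrier G"
    show "\<rho> (g \<otimes> h) = \<rho> g * \<rho> h"
    proof (rule eq_matI)
      fix i j assume "i < dim_row (\<rho> g * \<rho> h)" "j < dim_col (\<rho> g * \<rho> h)"
      then have ij: "i < n" "j < n" by (auto simp: \<rho>_def)
      obtain l where l: "l < n" "e l = h \<otimes> e j"
        using bij_betw_imp_surj_on[OF e] gh(2) ec[OF ij(2)] m_closed by (metis imageE lessThan_iff)
      have "(\<rho> g * \<rho> h) $$ (i, j) = (\<Sum>k<n. \<rho> g $$ (i, k) * \<rho> h $$ (k, j))"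
        by (rule mat_mult_index_sum[OF car car ij])
      also have "\<dots> = (\<Sum>k<n. if k = l then \<rho> g $$ (i, l) else 0)"
        using ij l einj by (intro sum.cong refl) (auto simp: \<rho>_def simp flip: l(2))
      also have "\<dots> = \<rho> (g \<otimes> h) $$ (i, j)"
        using ij l(1) gh ec by (simp add: \<rho>_def l(2) m_assoc)
      finally show "\<rho> (g \<otimes> h) $$ (i, j) = (\<rho> g * \<rho> h) $$ (i, j)" by simp
    qed (auto simp: \<rho>_def)
  qed (simp add: car)
  moreover have "rep_character G n \<rho> = convolution_one"
  proof
    fix g
    have "(\<Sum>i<n. \<rho> g $$ (i, i)) = (\<Sum>i<n. if g = \<one> then 1 else 0)" if g: "g \<in> carrier G"
    proof (intro sum.cong refl)
      fix i assume "i \<in> {..<n}"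
      then show "\<rho> g $$ (i, i) = (if g = \<one> then 1 else 0)"
        using g ec[of i] r_cancel_one'[of "e i" g] by (auto simp: \<rho>_def)
    qed
    then show "rep_character G n \<rho> g = convolution_one g"
      by (auto simp: rep_character_def convolution_one_def n_def)
  qed
  ultimately show ?thesis by blast
qed

text \<open>
  The regular character is the unit of convolution and a combination of finitely many
  irreducible characters. Convolving it with an irreducible \<open>\<eta>\<close> gives back \<open>\<eta>\<close>, which by
  orthogonality is possible only if \<open>\<eta>\<close> occurs with coefficient \<open>\<eta>(1)\<close>. So these finitely many
  characters are all of them.
\<close>

lemma finite_Irr_and_convolution_one:
  "finite (Irr G)" "convolution_one = (\<lambda>g. \<Sum>\<xi>\<in>Irr G. \<xi> \<one> * \<xi> g)"
proof -
  have "convolution_one \<in> irr_span G"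
    using regular_character rep_character_in_irr_span[OF is_group] by metis
  then obtain F c where F: "finite F" "F \<subseteq> Irr G" "convolution_one = (\<lambda>g. \<Sum>\<xi>\<in>F. c \<xi> * \<xi> g)"
    by (auto simp: irr_span_def)
  have coeff: "\<eta> \<in> F \<and> c \<eta> = \<eta> \<one>" if \<eta>: "\<eta> \<in> Irr G" for \<eta>
  proof -
    have "\<eta> \<one> = convolution G convolution_one \<eta> \<one>"
      using convolution_one_left[of \<eta>] Irr_outside[OF \<eta>] by simp
    also have "\<dots> = (\<Sum>\<xi>\<in>F. c \<xi> * convolution G \<xi> \<eta> \<one>)"
      unfolding F(3) convolution_sum_left ..
    also have "\<dots> = (\<Sum>\<xi>\<in>F. if \<xi> = \<eta> then c \<eta> else 0)"
      using F(2) \<eta> Irr_one_ne_zero[OF \<eta>] by (intro sum.cong refl) (auto simp: convolution_Irr)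
    also have "\<dots> = (if \<eta> \<in> F then c \<eta> else 0)" using F(1) by simp
    finally show ?thesis using Irr_one_ne_zero[OF \<eta>] by (auto split: if_splits)
  qed
  then have FI: "F = Irr G" using F(2) by blast
  then show "finite (Irr G)" using F(1) by simp
  show "convolution_one = (\<lambda>g. \<Sum>\<xi>\<in>Irr G. \<xi> \<one> * \<xi> g)"
    unfolding F(3) FI using coeff by (intro ext sum.cong) auto
qed

lemmas finite_Irr = finite_Irr_and_convolution_one(1)
lemmas convolution_one_eq = finite_Irr_and_convolution_one(2)

text \<open>
  The eigenvalue of convolution with \<open>\<alpha>\<close> on \<open>\<xi>\<close>; up to the factor \<open>|G|\<close> the scalar by which
  \<open>\<alpha>\<close>, as an element of the centre of the group algebra, acts on the representation dual to
  that of \<open>\<xi>\<close>.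
\<close>

definition central_value :: "('a \<Rightarrow> complex) \<Rightarrow> ('a \<Rightarrow> complex) \<Rightarrow> complex" where
  "central_value \<alpha> \<xi> = convolution G \<alpha> \<xi> \<one> / \<xi> \<one>"

lemma class_functionD:
  assumes "\<alpha> \<in> class_functions G"
  shows "g \<notin> carrier G \<Longrightarrow> \<alpha> g = 0"
    "g \<in> carrier G \<Longrightarrow> x \<in> carrier G \<Longrightarrow> \<alpha> (inv x \<otimes> g \<otimes> x) = \<alpha> g"
  using assms by (auto simp: class_functions_def)

text \<open>
  For a class function \<open>\<alpha>\<close> the matrix \<open>\<Sum>\<^sub>x \<alpha>(x) \<rho>(x\<inverse>)\<close> commutes with the representation, by
  conjugating the summation variable, hence is scalar, and convolving \<open>\<alpha>\<close> with the character
  of \<open>\<rho>\<close> multiplies by this scalar divided by \<open>|G|\<close>.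
\<close>

lemma convolution_class_function_Irr:
  assumes \<alpha>: "\<alpha> \<in> class_functions G" and \<xi>: "\<xi> \<in> Irr G"
  shows "convolution G \<alpha> \<xi> = (\<lambda>g. central_value \<alpha> \<xi> * \<xi> g)"
proof -
  obtain n \<rho> where \<rho>: "irreducible_rep G n \<rho>" and x: "\<xi> = rep_character G n \<rho>"
    using \<xi> by (auto simp: Irr_def)
  note rc = irreducible_repD(2)[OF \<rho>] and rm = irreducible_repD(3)[OF \<rho>]
  define T where "T = mat_sum n n (\<lambda>x. \<alpha> x \<cdot>\<^sub>m \<rho> (inv x)) (carrier G)"
  have sc: "\<alpha> x \<cdot>\<^sub>m \<rho> (inv x) \<in> carrier_mat n n" if "x \<in> carrier G" for x
    using rc[of "inv x"] that by simp
  have left: "\<rho> g * T = mat_sum n n (\<lambda>x. \<alpha> x \<cdot>\<^sub>m \<rho> (g \<otimes> inv x)) (carrier G)" if g: "g \<in> carrier G" for g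
  proof -
    have "\<rho> g * T = mat_sum n n (\<lambda>x. \<rho> g * (\<alpha> x \<cdot>\<^sub>m \<rho> (inv x))) (carrier G)"
      unfolding T_def by (rule mult_mat_sum[OF rc[OF g] sc])
    also have "\<dots> = mat_sum n n (\<lambda>x. \<alpha> x \<cdot>\<^sub>m \<rho> (g \<otimes> inv x)) (carrier G)"
      by (rule mat_sum_reindex[of id])
        (use g rc in \<open>auto simp: rm intro!: mult_smult_distrib[of _ n n _ n]\<close>)
    finally show ?thesis .
  qed
  have "\<rho> g * T = T * \<rho> g" if g: "g \<in> carrier G" for g
  proof -
    have "T * \<rho> g = mat_sum n n (\<lambda>x. \<alpha> x \<cdot>\<^sub>m \<rho> (inv x) * \<rho> g) (carrier G)"
      unfolding T_def by (rule mat_sum_mult[OF rc[OF g] sc])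
    also have "\<dots> = mat_sum n n (\<lambda>x. \<alpha> x \<cdot>\<^sub>m \<rho> (g \<otimes> inv x)) (carrier G)"
    proof (rule mat_sum_reindex[OF bij_conjugation[of "inv g"]])
      fix x assume x: "x \<in> carrier G"
      have "\<alpha> x \<cdot>\<^sub>m \<rho> (inv x) * \<rho> g = \<alpha> x \<cdot>\<^sub>m \<rho> (inv x \<otimes> g)"
        using rc[OF g] rc[of "inv x"] x g rm[of "inv x" g]
        by (simp add: mult_smult_assoc_mat[of _ n n _ n])
      moreover have "g \<otimes> inv (inv g \<otimes> x \<otimes> inv (inv g)) = inv x \<otimes> g"
        using x g by (simp add: inv_mult_group m_assoc) (simp flip: m_assoc)
      moreover have "\<alpha> (inv g \<otimes> x \<otimes> inv (inv g)) = \<alpha> x"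
        using class_functionD(2)[OF \<alpha> x g] g by simp
      ultimately show "\<alpha> x \<cdot>\<^sub>m \<rho> (inv x) * \<rho> g =
          \<alpha> (inv g \<otimes> x \<otimes> inv (inv g)) \<cdot>\<^sub>m \<rho> (g \<otimes> inv (inv g \<otimes> x \<otimes> inv (inv g)))"
        by (simp only:)
    qed (use g in simp)
    finally show ?thesis using left[OF g] by simp
  qed
  from schur_scalar[OF is_group \<rho> _ this]
  obtain c where c: "T = c \<cdot>\<^sub>m 1\<^sub>m n" by (auto simp: T_def)
  have eq: "convolution G \<alpha> \<xi> g = c / of_nat (card (carrier G)) * \<xi> g" for g
  proof (cases "g \<in> carrier G")
    case g: True
    have "(\<Sum>x\<in>carrier G. \<alpha> (x \<otimes> g) * \<xi> (inv x)) = (\<Sum>y\<in>carrier G. \<alpha> y * \<xi> (g \<otimes> inv y))"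
      using g by (subst sum.reindex_bij_betw[OF bij_mult_right[OF g], symmetric])
        (simp add: inv_mult_group flip: m_assoc)
    also have "\<dots> = (\<Sum>y\<in>carrier G. \<Sum>i<n. (\<alpha> y \<cdot>\<^sub>m \<rho> (g \<otimes> inv y)) $$ (i, i))"
    proof (intro sum.cong refl)
      fix y assume y: "y \<in> carrier G"
      then show "\<alpha> y * \<xi> (g \<otimes> inv y) = (\<Sum>i<n. (\<alpha> y \<cdot>\<^sub>m \<rho> (g \<otimes> inv y)) $$ (i, i))"
        using g rc[of "g \<otimes> inv y"] by (simp add: x rep_character_def sum_distrib_left)
    qed
    also have "\<dots> = (\<Sum>i<n. (\<rho> g * T) $$ (i, i))"
      unfolding left[OF g] by (subst sum.swap) simp
    also have "\<rho> g * T = c \<cdot>\<^sub>m \<rho> g"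
      using rc[OF g] by (simp add: c mult_smult_distrib[of _ n n _ n])
    also have "(\<Sum>i<n. (c \<cdot>\<^sub>m \<rho> g) $$ (i, i)) = c * \<xi> g"
      using g rc[OF g] by (simp add: x rep_character_def sum_distrib_left)
    finally show ?thesis using g by (simp add: convolution_def)
  next
    case False
    then show ?thesis using Irr_outside[OF \<xi>] by (simp add: convolution_def)
  qed
  then have "central_value \<alpha> \<xi> = c / of_nat (card (carrier G))"
    using Irr_one_ne_zero[OF \<xi>] by (simp add: central_value_def)
  then show ?thesis using eq by auto
qed

lemma central_value_expansion:
  assumes "\<eta> \<in> Irr G"
  shows "central_value (\<lambda>g. \<Sum>\<xi>\<in>Irr G. a \<xi> * (\<xi> \<one> * \<xi> g)) \<eta> = a \<eta>"
proof -
  have "convolution G (\<lambda>g. \<Sum>\<xi>\<in>Irr G. (a \<xi> * \<xi> \<one>) * \<xi> g) \<eta> \<one> =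
    (\<Sum>\<xi>\<in>Irr G. (a \<xi> * \<xi> \<one>) * convolution G \<xi> \<eta> \<one>)"
    unfolding convolution_sum_left ..
  also have "\<dots> = (\<Sum>\<xi>\<in>Irr G. if \<xi> = \<eta> then a \<eta> * \<eta> \<one> else 0)"
    using assms Irr_one_ne_zero by (intro sum.cong refl) (auto simp: convolution_Irr)
  also have "\<dots> = a \<eta> * \<eta> \<one>" using assms finite_Irr by simp
  finally show ?thesis
    using Irr_one_ne_zero[OF assms] by (simp add: central_value_def mult.assoc)
qed

text \<open>
  Convolve \<open>\<alpha>\<close> with the decomposition of the unit of convolution.
\<close>

lemma class_function_expansion:
  assumes "\<alpha> \<in> class_functions G"
  shows "\<alpha> = (\<lambda>g. \<Sum>\<xi>\<in>Irr G. central_value \<alpha> \<xi> * (\<xi> \<one> * \<xi> g))"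
proof -
  have "\<alpha> = convolution G \<alpha> convolution_one"
    using convolution_one_right class_functionD(1)[OF assms] by metis
  also have "\<dots> = (\<lambda>g. \<Sum>\<xi>\<in>Irr G. \<xi> \<one> * convolution G \<alpha> \<xi> g)"
    unfolding convolution_one_eq convolution_sum_right ..
  also have "\<dots> = (\<lambda>g. \<Sum>\<xi>\<in>Irr G. central_value \<alpha> \<xi> * (\<xi> \<one> * \<xi> g))"
    by (intro ext sum.cong refl) (simp add: convolution_class_function_Irr[OF assms])
  finally show ?thesis .
qed

text \<open>
  Expand \<open>\<beta>\<close> and let \<open>\<alpha>\<close> act on each term by its central value.
\<close>

lemma central_value_convolution:
  assumes \<alpha>: "\<alpha> \<in> class_functions G" and \<beta>: "\<beta> \<in> class_functions G" and \<eta>: "\<eta> \<in> Irr G"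
  shows "central_value (convolution G \<alpha> \<beta>) \<eta> = central_value \<alpha> \<eta> * central_value \<beta> \<eta>"
proof -
  have "convolution G \<alpha> \<beta> = convolution G \<alpha> (\<lambda>g. \<Sum>\<xi>\<in>Irr G. (central_value \<beta> \<xi> * \<xi> \<one>) * \<xi> g)"
    by (subst class_function_expansion[OF \<beta>]) (simp add: mult.assoc)
  also have "\<dots> = (\<lambda>g. \<Sum>\<xi>\<in>Irr G. (central_value \<beta> \<xi> * \<xi> \<one>) * convolution G \<alpha> \<xi> g)"
    by (rule convolution_sum_right)
  also have "\<dots> = (\<lambda>g. \<Sum>\<xi>\<in>Irr G. (central_value \<alpha> \<xi> * central_value \<beta> \<xi>) * (\<xi> \<one> * \<xi> g))"
    by (intro ext sum.cong refl) (simp add: convolution_class_function_Irr[OF \<alpha>])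
  finally show ?thesis
    using central_value_expansion[OF \<eta>, of "\<lambda>\<xi>. central_value \<alpha> \<xi> * central_value \<beta> \<xi>"] by simp
qed

lemma central_value_one: "\<xi> \<in> Irr G \<Longrightarrow> central_value convolution_one \<xi> = 1"
  using convolution_one_left[of \<xi>] Irr_outside[of \<xi>] Irr_one_ne_zero[of \<xi>]
  by (simp add: central_value_def)

lemma central_value_linear:
  "central_value (\<lambda>g. a * \<alpha> g + b * \<beta> g) \<xi> = a * central_value \<alpha> \<xi> + b * central_value \<beta> \<xi>"
  by (simp add: central_value_def convolution_def sum.distrib sum_distrib_left distrib_right
      add_divide_distrib mult.assoc)

end

section \<open>Level classes of an algebra of functions\<close>

text \<open>
  A point \<open>k\<close> outside the level class of \<open>i\<close> is separated from \<open>i\<close> by some \<open>b\<close>; the affine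
  function \<open>(b - b(k)) / (b(i) - b(k))\<close> is \<open>1\<close> on the level class and \<open>0\<close> at \<open>k\<close>, and
  the product of these over all \<open>k\<close> is the indicator. The closure conditions only concern
  values on \<open>I\<close>, so that the lemma applies to central values, which multiply only on
  irreducible characters.
\<close>

lemma indicator_of_level_class:
  fixes A :: "('i \<Rightarrow> 'k::field) set"
  assumes "finite I"
    and one: "\<exists>a\<in>A. \<forall>i\<in>I. a i = 1"
    and mult: "\<And>a b. a \<in> A \<Longrightarrow> b \<in> A \<Longrightarrow> \<exists>c\<in>A. \<forall>i\<in>I. c i = a i * b i"
    and lin: "\<And>a b x y. a \<in> A \<Longrightarrow> b \<in> A \<Longrightarrow> \<exists>c\<in>A. \<forall>i\<in>I. c i = x * a i + y * b i"
    and i: "i \<in> I"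
  shows "\<exists>a\<in>A. \<forall>j\<in>I. a j = (if \<forall>b\<in>A. b j = b i then 1 else 0)"
proof -
  let ?D = "{j \<in> I. \<exists>b\<in>A. b j \<noteq> b i}"
  have "\<exists>a\<in>A. (\<forall>j\<in>I. (\<forall>b\<in>A. b j = b i) \<longrightarrow> a j = 1) \<and> (\<forall>j\<in>J. a j = 0)"
    if "finite J" "J \<subseteq> ?D" for J
    using that
  proof (induction J rule: finite_induct)
    case empty
    show ?case using one by auto
  next
    case (insert k J)
    have "J \<subseteq> ?D" using insert.prems by simp
    from insert.IH[OF this] obtain a where a: "a \<in> A"
      "\<forall>j\<in>I. (\<forall>b\<in>A. b j = b i) \<longrightarrow> a j = 1" "\<forall>j\<in>J. a j = 0"
      by (elim bexE conjE)
    from insert.prems obtain b where b: "b \<in> A" "b k \<noteq> b i" and k: "k \<in> I" by blast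
    obtain u where u: "u \<in> A" "\<forall>j\<in>I. u j = 1" using one by blast
    obtain c where c: "c \<in> A" "\<forall>j\<in>I. c j = (1 / (b i - b k)) * b j + (- b k / (b i - b k)) * u j"
      using lin[OF b(1) u(1)] by blast
    have cj: "c j = (b j - b k) / (b i - b k)" if "j \<in> I" for j
      using c(2) u(2) that by (simp add: diff_divide_distrib)
    obtain d where d: "d \<in> A" "\<forall>j\<in>I. d j = a j * c j" using mult[OF a(1) c(1)] by blast
    have "d j = 1" if "j \<in> I" "\<forall>b\<in>A. b j = b i" for j
      using that d(2) a(2) cj b by auto
    moreover have "d j = 0" if "j \<in> insert k J" for j
      using that d(2) a(3) cj k insert.prems by auto
    ultimately show ?case using d(1) by blast
  qed
  from this[of ?D] \<open>finite I\<close> obtain a where a: "a \<in> A"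
    "\<And>j. j \<in> I \<Longrightarrow> \<forall>b\<in>A. b j = b i \<Longrightarrow> a j = 1" "\<And>j. j \<in> ?D \<Longrightarrow> a j = 0"
    by auto
  show ?thesis
    using a by (intro bexI[OF _ a(1)]) auto
qed

lemma partition_on_block_eq:
  assumes "partition_on A P" "K \<in> P" "L \<in> P" "x \<in> K" "x \<in> L"
  shows "K = L"
  using assms partition_onD2[OF assms(1)] by (auto simp: disjoint_def)

lemma superclass_theory_with_classes:
  assumes P: "partition_on (carrier H) P" and K: "K \<in> P" "g \<in> K"
  shows "superclass H (theory_with_classes H P) g = K"
proof
  have KH: "K \<subseteq> carrier H" using P K(1) by (auto simp: partition_on_def)
  have "(\<lambda>h. if h \<in> K then 1 else 0) \<in> theory_with_classes H P"
    using KH partition_on_block_eq[OF P K(1)] by (auto simp: theory_with_classes_def)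
  then have "(if h \<in> K then 1 else 0 :: complex) = (if g \<in> K then 1 else 0)"
    if "h \<in> superclass H (theory_with_classes H P) g" for h
    using that unfolding superclass_def by fast
  then show "superclass H (theory_with_classes H P) g \<subseteq> K"
    using K(2) by (metis one_neq_zero subsetI)
  show "K \<subseteq> superclass H (theory_with_classes H P) g"
    using KH K unfolding superclass_def theory_with_classes_def by blast
qed

lemma Cl_theory_with_classes:
  assumes P: "partition_on (carrier H) P"
  shows "Cl H (theory_with_classes H P) = P"
proof
  show "Cl H (theory_with_classes H P) \<subseteq> P"
  proof
    fix K assume "K \<in> Cl H (theory_with_classes H P)"
    then obtain g where g: "g \<in> carrier H" "K = superclass H (theory_with_classes H P) g"
      by (auto simp: Cl_def)
    obtain L where "L \<in> P" "g \<in> L" using P g(1) by (auto simp: partition_on_def)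
    then show "K \<in> P" using superclass_theory_with_classes[OF P] g(2) by simp
  qed
  show "P \<subseteq> Cl H (theory_with_classes H P)"
  proof
    fix K assume K: "K \<in> P"
    then have "K \<noteq> {}" using partition_onD3[OF P] by blast
    then obtain g where g: "g \<in> K" by blast
    then have "g \<in> carrier H" using P K by (auto simp: partition_on_def)
    then show "K \<in> Cl H (theory_with_classes H P)"
      using superclass_theory_with_classes[OF P K g] by (auto simp: Cl_def)
  qed
qed

section \<open>The partition of the irreducible characters\<close>

context finite_group
begin

lemma sigma_char_expansion:
  assumes "X \<subseteq> Irr G"
  shows "sigma_char G X = (\<lambda>g. \<Sum>\<xi>\<in>Irr G. (if \<xi> \<in> X then 1 else 0) * (\<xi> \<one> * \<xi> g))"
  unfolding sigma_char_def
  by (intro ext sum.mono_neutral_cong_left) (use assms finite_Irr in auto)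

lemma central_value_sigma_char:
  assumes "X \<subseteq> Irr G" "\<eta> \<in> Irr G"
  shows "central_value (sigma_char G X) \<eta> = (if \<eta> \<in> X then 1 else 0)"
  unfolding sigma_char_expansion[OF assms(1)] by (rule central_value_expansion[OF assms(2)])

lemma central_value_sum:
  "central_value (\<lambda>g. \<Sum>i\<in>I. c i * f i g) \<xi> = (\<Sum>i\<in>I. c i * central_value (f i) \<xi>)"
  by (simp add: central_value_def convolution_sum_left sum_divide_distrib)

lemma sigma_char_one_ne_zero:
  assumes "X \<subseteq> Irr G" "X \<noteq> {}"
  shows "sigma_char G X \<one> \<noteq> 0"
proof -
  have fin: "finite X" using assms(1) finite_Irr finite_subset by blast
  have "\<forall>\<xi>\<in>X. \<exists>n>0. \<xi> \<one> = of_nat n" using assms(1) Irr_one_pos_nat by blast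
  then obtain d where d: "\<And>\<xi>. \<xi> \<in> X \<Longrightarrow> d \<xi> > 0" "\<And>\<xi>. \<xi> \<in> X \<Longrightarrow> \<xi> \<one> = of_nat (d \<xi>)"
    by metis
  have "sigma_char G X \<one> = of_nat (\<Sum>\<xi>\<in>X. d \<xi> * d \<xi>)"
    by (simp add: sigma_char_def d(2))
  moreover have "(\<Sum>\<xi>\<in>X. d \<xi> * d \<xi>) > 0"
    using fin assms(2) d(1) by (intro sum_pos) auto
  ultimately show ?thesis by (metis of_nat_eq_0_iff less_irrefl)
qed

text \<open>
  Group the terms of the expansion of \<open>\<alpha>\<close> by the parts of the partition.
\<close>

lemma expansion_by_partition:
  assumes P: "partition_on (Irr G) P" and \<alpha>: "\<alpha> \<in> class_functions G"
    and const: "\<And>X \<xi> \<eta>. X \<in> P \<Longrightarrow> \<xi> \<in> X \<Longrightarrow> \<eta> \<in> X \<Longrightarrow> central_value \<alpha> \<xi> = central_value \<alpha> \<eta>"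
  shows "\<alpha> = (\<lambda>g. \<Sum>X\<in>P. central_value \<alpha> (SOME \<xi>. \<xi> \<in> X) * sigma_char G X g)"
proof
  fix g
  have UP: "\<Union>P = Irr G" and dis: "disjoint P" and ne: "{} \<notin> P"
    using P by (auto simp: partition_on_def)
  have "\<alpha> g = (\<Sum>\<xi>\<in>\<Union>P. central_value \<alpha> \<xi> * (\<xi> \<one> * \<xi> g))"
    unfolding UP by (subst class_function_expansion[OF \<alpha>]) simp
  also have "\<dots> = (\<Sum>X\<in>P. \<Sum>\<xi>\<in>X. central_value \<alpha> \<xi> * (\<xi> \<one> * \<xi> g))"
    using sum.Union_disjoint[of P] finite_Irr UP dis
    by (metis (no_types, lifting) Union_upper comp_apply disjoint_def finite_subset)
  also have "\<dots> = (\<Sum>X\<in>P. central_value \<alpha> (SOME \<xi>. \<xi> \<in> X) * sigma_char G X g)"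
  proof (intro sum.cong refl)
    fix X assume X: "X \<in> P"
    then have some: "(SOME \<xi>. \<xi> \<in> X) \<in> X" using ne by (metis all_not_in_conv someI_ex)
    show "(\<Sum>\<xi>\<in>X. central_value \<alpha> \<xi> * (\<xi> \<one> * \<xi> g)) = central_value \<alpha> (SOME \<xi>. \<xi> \<in> X) * sigma_char G X g"
      unfolding sigma_char_def sum_distrib_left
      by (intro sum.cong refl arg_cong2[where f = "(*)"] const[OF X _ some])
  qed
  finally show "\<alpha> g = (\<Sum>X\<in>P. central_value \<alpha> (SOME \<xi>. \<xi> \<in> X) * sigma_char G X g)" .
qed

lemma central_value_partition_sum:
  assumes P: "partition_on (Irr G) P" and "X \<in> P" "\<xi> \<in> X"
  shows "central_value (\<lambda>g. \<Sum>Y\<in>P. c Y * sigma_char G Y g) \<xi> = c X"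
proof -
  have sub: "Y \<subseteq> Irr G" if "Y \<in> P" for Y using P that by (auto simp: partition_on_def)
  have \<xi>: "\<xi> \<in> Irr G" using sub[OF assms(2)] assms(3) by blast
  have "finite P" using P finite_Irr finite_elements by blast
  have "(\<Sum>Y\<in>P. c Y * central_value (sigma_char G Y) \<xi>) = (\<Sum>Y\<in>P. if Y = X then c X else 0)"
  proof (intro sum.cong refl)
    fix Y assume Y: "Y \<in> P"
    show "c Y * central_value (sigma_char G Y) \<xi> = (if Y = X then c X else 0)"
    proof (cases "Y = X")
      case True
      then show ?thesis
        using central_value_sigma_char[OF sub[OF Y] \<xi>] assms(3) by simp
    next
      case False
      then have "\<xi> \<notin> Y" using partition_on_block_eq[OF P Y assms(2) _ assms(3)] by blast
      then show ?thesis
        using central_value_sigma_char[OF sub[OF Y] \<xi>] False by simp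
    qed
  qed
  then show ?thesis using \<open>finite P\<close> assms(2) by (simp add: central_value_sum)
qed

end

locale supercharacter_group = finite_group +
  fixes S :: "('a \<Rightarrow> complex) set"
  assumes theory_S: "supercharacter_theory G S"
begin

lemma class_function_S: "\<alpha> \<in> S \<Longrightarrow> \<alpha> \<in> class_functions G"
  and zero_S: "(\<lambda>_. 0) \<in> S"
  and add_S: "\<alpha> \<in> S \<Longrightarrow> \<beta> \<in> S \<Longrightarrow> (\<lambda>g. \<alpha> g + \<beta> g) \<in> S"
  and scale_S: "\<alpha> \<in> S \<Longrightarrow> (\<lambda>g. c * \<alpha> g) \<in> S"
  and times_S: "\<alpha> \<in> S \<Longrightarrow> \<beta> \<in> S \<Longrightarrow> (\<lambda>g. \<alpha> g * \<beta> g) \<in> S"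
  and convolution_S: "\<alpha> \<in> S \<Longrightarrow> \<beta> \<in> S \<Longrightarrow> convolution G \<alpha> \<beta> \<in> S"
  and one_S: "(\<lambda>g. if g \<in> carrier G then 1 else 0) \<in> S"
  and convolution_one_S: "convolution_one \<in> S"
  using theory_S unfolding supercharacter_theory_def convolution_one_def by blast+

lemma linear_S: "\<alpha> \<in> S \<Longrightarrow> \<beta> \<in> S \<Longrightarrow> (\<lambda>g. a * \<alpha> g + b * \<beta> g) \<in> S"
  using add_S[OF scale_S scale_S] by blast

lemma sum_S: "finite I \<Longrightarrow> (\<And>i. i \<in> I \<Longrightarrow> f i \<in> S) \<Longrightarrow> (\<lambda>g. \<Sum>i\<in>I. c i * f i g) \<in> S"
proof (induction I rule: finite_induct)
  case empty
  show ?case using zero_S by simp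
next
  case (insert i I)
  then show ?case using add_S[OF scale_S[of "f i" "c i"]] by simp
qed

lemma outside_S: "\<alpha> \<in> S \<Longrightarrow> g \<notin> carrier G \<Longrightarrow> \<alpha> g = 0"
  using class_function_S class_functionD(1) by blast

lemma superclass_self: "g \<in> carrier G \<Longrightarrow> g \<in> superclass G S g"
  by (simp add: superclass_def)

lemma superclass_subset: "superclass G S g \<subseteq> carrier G"
  by (auto simp: superclass_def)

lemma superclass_eq: "h \<in> superclass G S g \<Longrightarrow> superclass G S h = superclass G S g"
  by (auto simp: superclass_def)

lemma partition_Cl: "partition_on (carrier G) (Cl G S)"
proof (rule partition_onI)
  show "\<Union> (Cl G S) = carrier G"
    using superclass_self superclass_subset by (auto simp: Cl_def)
  show "disjnt K L" if "K \<in> Cl G S" "L \<in> Cl G S" "K \<noteq> L" for K L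
    using that superclass_eq unfolding Cl_def disjnt_iff by (metis imageE)
  show "{} \<notin> Cl G S"
    using superclass_self by (auto simp: Cl_def)
qed

text \<open>
  The level classes of \<open>S\<close> under pointwise multiplication are the superclasses.
\<close>

lemma indicator_superclass_S:
  assumes g: "g \<in> carrier G"
  shows "(\<lambda>h. if h \<in> superclass G S g then 1 else 0) \<in> S"
proof -
  have "\<exists>a\<in>S. \<forall>h\<in>carrier G. a h = (if \<forall>b\<in>S. b h = b g then 1 else 0)"
  proof (rule indicator_of_level_class[OF finite_carrier _ _ _ g])
    show "\<exists>a\<in>S. \<forall>h\<in>carrier G. a h = 1" using one_S by (intro bexI[OF _ one_S]) simp
    show "\<exists>c\<in>S. \<forall>h\<in>carrier G. c h = a h * b h" if "a \<in> S" "b \<in> S" for a b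
      by (rule bexI[OF _ times_S[OF that]]) simp
    show "\<exists>c\<in>S. \<forall>h\<in>carrier G. c h = x * a h + y * b h" if "a \<in> S" "b \<in> S" for a b x y
      by (rule bexI[OF _ linear_S[OF that, of x y]]) simp
  qed
  then obtain a where a: "a \<in> S" "\<And>h. h \<in> carrier G \<Longrightarrow> a h = (if \<forall>b\<in>S. b h = b g then 1 else 0)"
    by blast
  have "a = (\<lambda>h. if h \<in> superclass G S g then 1 else 0)"
  proof
    fix h
    show "a h = (if h \<in> superclass G S g then 1 else 0)"
      using a outside_S[OF a(1), of h] by (cases "h \<in> carrier G") (auto simp: superclass_def)
  qed
  then show ?thesis using a(1) by simp
qed

lemma finite_Cl: "finite (Cl G S)"
  using finite_carrier by (simp add: Cl_def)

lemma indicator_S: "K \<in> Cl G S \<Longrightarrow> (\<lambda>h. if h \<in> K then 1 else 0) \<in> S"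
  using indicator_superclass_S by (auto simp: Cl_def)

lemma constant_on_superclass:
  "\<alpha> \<in> S \<Longrightarrow> K \<in> Cl G S \<Longrightarrow> g \<in> K \<Longrightarrow> h \<in> K \<Longrightarrow> \<alpha> g = \<alpha> h"
  by (auto simp: Cl_def superclass_def)

lemma expansion_by_superclasses:
  fixes f :: "'a \<Rightarrow> complex"
  assumes "\<And>g. g \<notin> carrier G \<Longrightarrow> f g = 0"
    and const: "\<And>K g h. K \<in> Cl G S \<Longrightarrow> g \<in> K \<Longrightarrow> h \<in> K \<Longrightarrow> f g = f h"
  shows "f = (\<lambda>g. \<Sum>K\<in>Cl G S. f (SOME k. k \<in> K) * (if g \<in> K then 1 else 0))"
proof
  fix g
  show "f g = (\<Sum>K\<in>Cl G S. f (SOME k. k \<in> K) * (if g \<in> K then 1 else 0))"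
  proof (cases "g \<in> carrier G")
    case True
    then obtain L where L: "L \<in> Cl G S" "g \<in> L" using partition_Cl by (auto simp: partition_on_def)
    have "(\<Sum>K\<in>Cl G S. f (SOME k. k \<in> K) * (if g \<in> K then 1 else 0)) =
      (\<Sum>K\<in>Cl G S. if K = L then f g else 0)"
    proof (intro sum.cong refl)
      fix K assume K: "K \<in> Cl G S"
      show "f (SOME k. k \<in> K) * (if g \<in> K then 1 else 0) = (if K = L then f g else 0)"
      proof (cases "K = L")
        case True
        then show ?thesis
          using const[OF L(1) L(2) someI[of "\<lambda>k. k \<in> L", OF L(2)]] L(2) by simp
      next
        case False
        then have "g \<notin> K" using partition_on_block_eq[OF partition_Cl K L(1) _ L(2)] by blast
        then show ?thesis using False by simp
      qed
    qed
    then show ?thesis using finite_Cl L(1) by simp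
  next
    case False
    then have "g \<notin> K" if "K \<in> Cl G S" for K using that superclass_subset by (auto simp: Cl_def)
    then show ?thesis using assms(1)[OF False] by simp
  qed
qed

lemma S_eq_theory_with_classes: "S = theory_with_classes G (Cl G S)"
proof
  show "S \<subseteq> theory_with_classes G (Cl G S)"
    using outside_S constant_on_superclass by (auto simp: theory_with_classes_def)
  show "theory_with_classes G (Cl G S) \<subseteq> S"
  proof
    fix f assume f: "f \<in> theory_with_classes G (Cl G S)"
    have "f = (\<lambda>g. \<Sum>K\<in>Cl G S. f (SOME k. k \<in> K) * (if g \<in> K then 1 else 0))"
      by (rule expansion_by_superclasses)
        (use f in \<open>unfold theory_with_classes_def, blast+\<close>)
    also have "\<dots> \<in> S" by (intro sum_S finite_Cl indicator_S)
    finally show "f \<in> S" .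
  qed
qed

definition irr_block :: "('a \<Rightarrow> complex) \<Rightarrow> ('a \<Rightarrow> complex) set" where
  "irr_block \<xi> = {\<eta> \<in> Irr G. \<forall>\<alpha>\<in>S. central_value \<alpha> \<eta> = central_value \<alpha> \<xi>}"

definition irr_blocks :: "('a \<Rightarrow> complex) set set" where
  "irr_blocks = irr_block ` Irr G"

lemma partition_irr_blocks: "partition_on (Irr G) irr_blocks"
  by (rule partition_onI) (auto simp: irr_blocks_def irr_block_def disjnt_iff)

text \<open>
  The central values of members of \<open>S\<close> form an algebra on \<open>Irr G\<close>, so \<open>S\<close> contains a function
  whose central values are the indicator of \<open>X\<close>; a class function is determined by its central
  values.
\<close>

lemma sigma_char_block_S:
  assumes "X \<in> irr_blocks"
  shows "sigma_char G X \<in> S"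
proof -
  obtain \<xi> where \<xi>: "\<xi> \<in> Irr G" "X = irr_block \<xi>" using assms by (auto simp: irr_blocks_def)
  have "\<exists>a\<in>central_value ` S. \<forall>\<eta>\<in>Irr G. a \<eta> = (if \<forall>b\<in>central_value ` S. b \<eta> = b \<xi> then 1 else 0)"
  proof (rule indicator_of_level_class[OF finite_Irr _ _ _ \<xi>(1)])
    show "\<exists>a\<in>central_value ` S. \<forall>\<eta>\<in>Irr G. a \<eta> = 1"
      using convolution_one_S central_value_one by blast
    show "\<exists>c\<in>central_value ` S. \<forall>\<eta>\<in>Irr G. c \<eta> = a \<eta> * b \<eta>"
      if "a \<in> central_value ` S" "b \<in> central_value ` S" for a b
      using that convolution_S central_value_convolution class_function_S by fastforce
    show "\<exists>c\<in>central_value ` S. \<forall>\<eta>\<in>Irr G. c \<eta> = x * a \<eta> + y * b \<eta>"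
      if ab: "a \<in> central_value ` S" "b \<in> central_value ` S" for a b x y
    proof -
      obtain \<alpha> \<beta> where "\<alpha> \<in> S" "a = central_value \<alpha>" "\<beta> \<in> S" "b = central_value \<beta>"
        using ab by blast
      then show ?thesis
        by (intro bexI[OF _ imageI[OF linear_S[of \<alpha> \<beta> x y]]]) (simp_all add: central_value_linear)
    qed
  qed
  then obtain \<alpha> where \<alpha>: "\<alpha> \<in> S" "\<And>\<eta>. \<eta> \<in> Irr G \<Longrightarrow> central_value \<alpha> \<eta> = (if \<eta> \<in> X then 1 else 0)"
    unfolding \<xi>(2) irr_block_def by fastforce
  have "X \<subseteq> Irr G" using \<xi>(2) by (auto simp: irr_block_def)
  then have "\<alpha> = sigma_char G X"
    using class_function_expansion[OF class_function_S[OF \<alpha>(1)]]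
    by (simp add: sigma_char_expansion \<alpha>(2) cong: sum.cong)
  then show ?thesis using \<alpha>(1) by simp
qed

lemma finite_irr_blocks: "finite irr_blocks"
  using finite_Irr by (simp add: irr_blocks_def)

lemma expansion_by_blocks:
  assumes "\<alpha> \<in> S"
  shows "\<alpha> = (\<lambda>g. \<Sum>X\<in>irr_blocks. central_value \<alpha> (SOME \<xi>. \<xi> \<in> X) * sigma_char G X g)"
  by (rule expansion_by_partition[OF partition_irr_blocks class_function_S[OF assms]])
    (use assms in \<open>auto simp: irr_blocks_def irr_block_def\<close>)

lemma S_eq_span: "S = {\<lambda>g. \<Sum>X\<in>irr_blocks. c X * sigma_char G X g | c. True}"
proof (intro subset_antisym subsetI)
  fix \<alpha> assume "\<alpha> \<in> S"
  from expansion_by_blocks[OF this]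
  show "\<alpha> \<in> {\<lambda>g. \<Sum>X\<in>irr_blocks. c X * sigma_char G X g | c. True}"
    by (intro CollectI exI[of _ "\<lambda>X. central_value \<alpha> (SOME \<xi>. \<xi> \<in> X)"] conjI TrueI)
next
  fix \<alpha> assume "\<alpha> \<in> {\<lambda>g. \<Sum>X\<in>irr_blocks. c X * sigma_char G X g | c. True}"
  then obtain c where "\<alpha> = (\<lambda>g. \<Sum>X\<in>irr_blocks. c X * sigma_char G X g)" by blast
  then show "\<alpha> \<in> S" using sum_S[OF finite_irr_blocks, of "sigma_char G"] sigma_char_block_S by simp
qed

lemma some_in_block: "X \<in> irr_blocks \<Longrightarrow> (SOME \<xi>. \<xi> \<in> X) \<in> X"
  using partition_irr_blocks by (metis all_not_in_conv partition_onD3 someI_ex)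

lemma some_in_superclass: "K \<in> Cl G S \<Longrightarrow> (SOME g. g \<in> K) \<in> K"
  using partition_Cl by (metis all_not_in_conv partition_onD3 someI_ex)

text \<open>
  The indicators of the superclasses and the functions \<open>\<sigma>\<^sub>X\<close> of the blocks are two bases of
  \<open>S\<close>. The matrices \<open>a\<close> and \<open>b\<close> that express one in terms of the other have products \<open>ab\<close> and
  \<open>ba\<close> with ones on the diagonal, and these products have the same trace.
\<close>

lemma card_irr_blocks: "card irr_blocks = card (Cl G S)"
proof -
  let ?k = "\<lambda>K::'a set. SOME g. g \<in> K" and ?x = "\<lambda>X::('a \<Rightarrow> complex) set. SOME \<xi>. \<xi> \<in> X"
  let ?ind = "\<lambda>K::'a set. \<lambda>g. if g \<in> K then 1 else (0::complex)"
  define a where "a X K = sigma_char G X (?k K)" for X K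
  define b where "b K X = central_value (?ind K) (?x X)" for K X
  have "(\<Sum>K\<in>Cl G S. a X K * b K X) = 1" if X: "X \<in> irr_blocks" for X
  proof -
    have "sigma_char G X = (\<lambda>g. \<Sum>K\<in>Cl G S. a X K * ?ind K g)"
      unfolding a_def
      by (rule expansion_by_superclasses)
        (use sigma_char_block_S[OF X] outside_S constant_on_superclass in blast)+
    then have "central_value (sigma_char G X) (?x X) = (\<Sum>K\<in>Cl G S. a X K * b K X)"
      unfolding b_def by (simp only: central_value_sum)
    moreover have "X \<subseteq> Irr G" using X by (auto simp: irr_blocks_def irr_block_def)
    ultimately show ?thesis
      using some_in_block[OF X] central_value_sigma_char[of X "?x X"] by auto
  qed
  moreover have "(\<Sum>X\<in>irr_blocks. b K X * a X K) = 1" if K: "K \<in> Cl G S" for K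
    using fun_cong[OF expansion_by_blocks[OF indicator_S[OF K]], of "?k K"] some_in_superclass[OF K]
    by (simp add: a_def b_def)
  moreover have "(\<Sum>X\<in>irr_blocks. \<Sum>K\<in>Cl G S. a X K * b K X) = (\<Sum>K\<in>Cl G S. \<Sum>X\<in>irr_blocks. b K X * a X K)"
    by (subst sum.swap) (simp add: mult.commute)
  ultimately have "of_nat (card irr_blocks) = (of_nat (card (Cl G S)) :: complex)"
    by simp
  then show ?thesis by simp
qed

lemma irr_partition_irr_blocks: "irr_partition G S irr_blocks"
  unfolding irr_partition_def
  using partition_irr_blocks card_irr_blocks S_eq_span sigma_char_block_S constant_on_superclass
  by blast

text \<open>
  If the functions \<open>\<sigma>\<^sub>X\<close> span \<open>S\<close>, then the central values of members of \<open>S\<close> are constant on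
  each part, and those of \<open>\<sigma>\<^sub>X \<in> S\<close> separate \<open>X\<close> from the other parts. So the parts are the
  level classes.
\<close>

lemma irr_partition_unique:
  assumes "irr_partition G S P"
  shows "P = irr_blocks"
proof -
  note parts = assms[unfolded irr_partition_def]
  note P = parts[THEN conjunct1] and span = parts[THEN conjunct2, THEN conjunct2, THEN conjunct2]
  have block: "X = irr_block \<xi>" if X: "X \<in> P" "\<xi> \<in> X" for X \<xi>
  proof
    have XI: "X \<subseteq> Irr G" using P X by (auto simp: partition_on_def)
    show "X \<subseteq> irr_block \<xi>"
    proof
      fix \<eta> assume \<eta>: "\<eta> \<in> X"
      have "central_value \<alpha> \<eta> = central_value \<alpha> \<xi>" if "\<alpha> \<in> S" for \<alpha>
      proof -
        from that[unfolded span] obtain c where "\<alpha> = (\<lambda>g. \<Sum>X\<in>P. c X * sigma_char G X g)"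
          by (elim CollectE exE conjE)
        then show ?thesis
          using central_value_partition_sum[OF P X(1) \<eta>] central_value_partition_sum[OF P X] by simp
      qed
      then show "\<eta> \<in> irr_block \<xi>" using \<eta> XI by (auto simp: irr_block_def)
    qed
    have finP: "finite P" using P finite_Irr finite_elements by blast
    have "(\<lambda>g. \<Sum>Y\<in>P. (if Y = X then 1 else 0) * sigma_char G Y g) \<in> S"
      unfolding span by (intro CollectI exI[of _ "\<lambda>Y. if Y = X then 1 else 0"]) simp
    also have "(\<lambda>g. \<Sum>Y\<in>P. (if Y = X then 1 else 0) * sigma_char G Y g) = sigma_char G X"
      using finP X(1) by (simp add: if_distrib[of "\<lambda>c. c * _"] cong: if_cong)
    finally have sX: "sigma_char G X \<in> S" .
    show "irr_block \<xi> \<subseteq> X"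
    proof
      fix \<eta> assume "\<eta> \<in> irr_block \<xi>"
      then have "\<eta> \<in> Irr G" "central_value (sigma_char G X) \<eta> = central_value (sigma_char G X) \<xi>"
        using sX by (auto simp: irr_block_def)
      then show "\<eta> \<in> X" using XI X(2) central_value_sigma_char[OF XI] by (auto split: if_splits)
    qed
  qed
  have UP: "\<Union>P = Irr G" and ne: "{} \<notin> P" using partition_onD1[OF P] partition_onD3[OF P] by simp_all
  show ?thesis
  proof (intro subset_antisym subsetI)
    fix X assume X: "X \<in> P"
    then obtain \<xi> where "\<xi> \<in> X" using ne by (metis all_not_in_conv)
    then show "X \<in> irr_blocks"
      using block[OF X] X UP unfolding irr_blocks_def by blast
  next
    fix X assume "X \<in> irr_blocks"
    then obtain \<xi> where \<xi>: "\<xi> \<in> Irr G" "X = irr_block \<xi>" by (auto simp: irr_blocks_def)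
    then obtain Y where "Y \<in> P" "\<xi> \<in> Y" using UP by blast
    then show "X \<in> P" using block \<xi>(2) by simp
  qed
qed

lemma supercharacters_eq: "supercharacters G S = sigma_char G ` irr_blocks"
  unfolding supercharacters_def
  using irr_partition_irr_blocks irr_partition_unique by (metis the_equality)

end

section \<open>Averaging over the cosets of a normal subgroup\<close>

context supercharacter_group
begin

lemma S_normal_superclass:
  assumes N: "S_normal G S N" and h: "h \<in> superclass G S g" and g: "g \<in> carrier G"
  shows "h \<in> N \<longleftrightarrow> g \<in> N"
proof -
  obtain \<K> where \<K>: "\<K> \<subseteq> Cl G S" "N = \<Union>\<K>" using N by (auto simp: S_normal_def)
  have K: "superclass G S g \<in> Cl G S" "g \<in> superclass G S g"
    using g superclass_self by (auto simp: Cl_def)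
  have "superclass G S g \<in> \<K>" if x: "x \<in> superclass G S g" "x \<in> N" for x
  proof -
    obtain L where "L \<in> \<K>" "x \<in> L" using x \<K>(2) by blast
    then show ?thesis
      using partition_on_block_eq[OF partition_Cl K(1), of L x] \<K>(1) x(1) by blast
  qed
  then show ?thesis using K(2) h \<K>(2) by blast
qed

lemma S_normal_subgroup: "S_normal G S N \<Longrightarrow> subgroup N G"
  by (simp add: S_normal_def)

text \<open>
  The superclasses are closed under conjugation because \<open>S\<close> consists of class functions.
\<close>

lemma S_normal_normal:
  assumes "S_normal G S N"
  shows "N \<lhd> G"
  unfolding normal_inv_iff
proof (intro conjI ballI)
  show "subgroup N G" by (rule S_normal_subgroup[OF assms])
  fix x h assume x: "x \<in> carrier G" and h: "h \<in> N"
  have hc: "h \<in> carrier G" by (rule subgroup.mem_carrier[OF S_normal_subgroup[OF assms] h])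
  have "x \<otimes> h \<otimes> inv x \<in> superclass G S h"
    unfolding superclass_def
  proof (intro CollectI conjI ballI)
    show "x \<otimes> h \<otimes> inv x \<in> carrier G" using x hc by simp
    show "\<alpha> (x \<otimes> h \<otimes> inv x) = \<alpha> h" if "\<alpha> \<in> S" for \<alpha>
      using class_functionD(2)[OF class_function_S[OF that] hc, of "inv x"] x by simp
  qed
  then show "x \<otimes> h \<otimes> inv x \<in> N"
    using S_normal_superclass[OF assms _ hc] h by simp
qed

end

locale supercharacter_group_normal = supercharacter_group +
  fixes M :: "'a set"
  assumes normal_M: "S_normal G S M"
begin

sublocale M: subgroup M G by (rule S_normal_subgroup[OF normal_M])

lemma finite_M: "finite M"
  using finite_carrier M.subset finite_subset by blast

lemma card_M_nz: "of_nat (card M) \<noteq> (0::complex)"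
proof -
  have "M \<noteq> {}" using M.one_closed by blast
  then show ?thesis using finite_M by simp
qed

lemma mem_rcos_iff:
  assumes "g \<in> carrier G"
  shows "h \<in> M #> g \<longleftrightarrow> (\<exists>m\<in>M. h = g \<otimes> m)"
proof -
  have "M #> g = g <# M" using normal.coset_eq[OF S_normal_normal[OF normal_M]] assms by blast
  then show ?thesis by (auto simp: l_coset_def)
qed

lemma rcos_mult_right: "g \<in> carrier G \<Longrightarrow> m \<in> M \<Longrightarrow> M #> (g \<otimes> m) = M #> g"
  using mem_rcos_iff[of g "g \<otimes> m"] repr_independence[of "g \<otimes> m" M g] M.subgroup_axioms by auto

text \<open>
  The idempotent for convolution that belongs to \<open>M\<close>, with the indicator of \<open>M\<close> scaled to make
  up for the factor \<open>1/|G|\<close> in the convolution.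
\<close>

definition averaging :: "'a \<Rightarrow> complex" where
  "averaging = (\<lambda>g. if g \<in> M then of_nat (card (carrier G)) / of_nat (card M) else 0)"

lemma averaging_S: "averaging \<in> S"
proof -
  have "averaging \<in> theory_with_classes G (Cl G S)"
    unfolding theory_with_classes_def
  proof (intro CollectI conjI allI impI ballI)
    show "averaging g = 0" if "g \<notin> carrier G" for g
      using that M.mem_carrier by (auto simp: averaging_def)
    fix K g h assume K: "K \<in> Cl G S" "g \<in> K" "h \<in> K"
    then obtain k where k: "k \<in> carrier G" "K = superclass G S k" by (auto simp: Cl_def)
    have "g \<in> M \<longleftrightarrow> h \<in> M"
      using S_normal_superclass[OF normal_M _ k(1)] K k(2) by blast
    then show "averaging g = averaging h" by (simp add: averaging_def)
  qed
  then show ?thesis using S_eq_theory_with_classes by simp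
qed

text \<open>
  Only the terms with \<open>xg \<in> M\<close> survive; substituting \<open>m\<inverse>\<close> for \<open>xg\<close> turns them into values of
  \<open>\<alpha>\<close> on \<open>gM\<close>.
\<close>

lemma convolution_averaging:
  assumes g: "g \<in> carrier G"
  shows "convolution G averaging \<alpha> g = (\<Sum>m\<in>M. \<alpha> (g \<otimes> m)) / of_nat (card M)"
proof -
  let ?c = "of_nat (card (carrier G)) / of_nat (card M) :: complex"
  have "(\<Sum>x\<in>carrier G. averaging (x \<otimes> g) * \<alpha> (inv x)) = (\<Sum>y\<in>carrier G. averaging y * \<alpha> (g \<otimes> inv y))"
    using g by (subst sum.reindex_bij_betw[OF bij_mult_right[OF g], symmetric])
      (simp add: inv_mult_group flip: m_assoc)
  also have "\<dots> = (\<Sum>y\<in>M. ?c * \<alpha> (g \<otimes> inv y))"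
    by (rule sum.mono_neutral_cong_right) (use finite_carrier M.subset in \<open>auto simp: averaging_def\<close>)
  also have "\<dots> = (\<Sum>m\<in>M. ?c * \<alpha> (g \<otimes> m))"
    by (rule sum.reindex_bij_witness[of _ "\<lambda>m. inv m" "\<lambda>m. inv m"]) auto
  also have "\<dots> = ?c * (\<Sum>m\<in>M. \<alpha> (g \<otimes> m))" by (simp add: sum_distrib_left)
  finally show ?thesis using g card_nz by (simp add: convolution_def)
qed

text \<open>
  The averaging element lies in \<open>S\<close>, so it has the same central value \<open>w\<close> on all characters of
  the block \<open>X\<close>.
\<close>

lemma sum_coset_sigma_char:
  assumes X: "X \<in> irr_blocks"
  obtains w where "\<And>g. g \<in> carrier G \<Longrightarrow>
    (\<Sum>m\<in>M. sigma_char G X (g \<otimes> m)) = of_nat (card M) * (w * sigma_char G X g)"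
proof -
  obtain \<xi> where \<xi>: "X = irr_block \<xi>" using X by (auto simp: irr_blocks_def)
  let ?w = "central_value averaging \<xi>"
  have conv: "convolution G averaging (sigma_char G X) g = ?w * sigma_char G X g" for g
  proof -
    have "convolution G averaging (sigma_char G X) g = (\<Sum>\<eta>\<in>X. \<eta> \<one> * convolution G averaging \<eta> g)"
      unfolding sigma_char_def convolution_sum_right ..
    also have "\<dots> = (\<Sum>\<eta>\<in>X. ?w * (\<eta> \<one> * \<eta> g))"
    proof (intro sum.cong refl)
      fix \<eta> assume "\<eta> \<in> X"
      then have \<eta>: "\<eta> \<in> Irr G" "central_value averaging \<eta> = ?w"
        using averaging_S by (auto simp: \<xi> irr_block_def)
      show "\<eta> \<one> * convolution G averaging \<eta> g = ?w * (\<eta> \<one> * \<eta> g)"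
        using convolution_class_function_Irr[OF class_function_S[OF averaging_S] \<eta>(1)] \<eta>(2) by simp
    qed
    finally show ?thesis by (simp add: sigma_char_def sum_distrib_left)
  qed
  show ?thesis
  proof (rule that[of ?w])
    fix g assume "g \<in> carrier G"
    from convolution_averaging[OF this, of "sigma_char G X"]
    show "(\<Sum>m\<in>M. sigma_char G X (g \<otimes> m)) = of_nat (card M) * (?w * sigma_char G X g)"
      using card_M_nz by (simp add: conv field_simps)
  qed
qed

text \<open>
  On a coset \<open>gM\<close> a supercharacter \<open>\<sigma>\<^sub>X\<close> has mean \<open>w \<sigma>\<^sub>X(g)\<close>. Where the supercharacters over
  \<open>M\<close> vanish, all supercharacters agree with their means, and so does the indicator of the
  superclass of \<open>g\<close>; a mean \<open>1\<close> of an indicator forces the coset into the superclass.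
  Conversely, if the coset lies in the superclass, then \<open>\<sigma>\<^sub>X(g) \<noteq> 0\<close> forces \<open>w = 1\<close>, so
  \<open>\<sigma>\<^sub>X\<close> is constant on \<open>M\<close>.
\<close>

lemma supercharacters_over_vanish_iff:
  assumes N: "S_normal G S N" and MN: "M \<subseteq> N"
  shows "(\<forall>g\<in>carrier G - N. \<forall>\<chi>\<in>supercharacters_over G S M. \<chi> g = 0) \<longleftrightarrow>
    (\<forall>g\<in>carrier G - N. \<forall>m\<in>M. g \<otimes> m \<in> superclass G S g)" (is "?V \<longleftrightarrow> ?C")
proof
  assume V: ?V
  show ?C
  proof (intro ballI)
    fix g m assume g: "g \<in> carrier G - N" and m: "m \<in> M"
    then have gc: "g \<in> carrier G" by simp
    have avg: "(\<Sum>m\<in>M. sigma_char G X (g \<otimes> m)) = of_nat (card M) * sigma_char G X g"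
      if X: "X \<in> irr_blocks" for X
    proof -
      obtain w where w: "\<And>g. g \<in> carrier G \<Longrightarrow>
          (\<Sum>m\<in>M. sigma_char G X (g \<otimes> m)) = of_nat (card M) * (w * sigma_char G X g)"
        using sum_coset_sigma_char[OF X] by blast
      show ?thesis
      proof (cases "M \<subseteq> char_kernel G (sigma_char G X)")
        case True
        have "(\<Sum>m\<in>M. sigma_char G X (\<one> \<otimes> m)) = (\<Sum>m\<in>M. sigma_char G X \<one>)"
          using True M.mem_carrier by (intro sum.cong refl) (auto simp: char_kernel_def)
        then have "w * sigma_char G X \<one> = sigma_char G X \<one>"
          using w[OF one_closed] card_M_nz by simp
        moreover have "sigma_char G X \<one> \<noteq> 0"
          using X partition_irr_blocks by (intro sigma_char_one_ne_zero) (auto simp: partition_on_def)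
        ultimately have "w = 1" by simp
        then show ?thesis using w[OF gc] by simp
      next
        case False
        then have "sigma_char G X \<in> supercharacters_over G S M"
          using X by (simp add: supercharacters_over_def supercharacters_eq)
        then have "sigma_char G X g = 0" using V g by blast
        then show ?thesis using w[OF gc] by simp
      qed
    qed
    \<comment> \<open>The coset averages at \<open>g\<close> are known on the spanning set, hence for the indicator of \<open>K\<close>.\<close>
    let ?K = "superclass G S g"
    let ?ind = "\<lambda>h. if h \<in> ?K then 1 else (0::complex)"
    define c where "c X = central_value ?ind (SOME \<xi>. \<xi> \<in> X)" for X
    have c: "?ind = (\<lambda>h. \<Sum>X\<in>irr_blocks. c X * sigma_char G X h)"
      unfolding c_def by (rule expansion_by_blocks[OF indicator_superclass_S[OF gc]])
    have "(\<Sum>m\<in>M. ?ind (g \<otimes> m)) = (\<Sum>X\<in>irr_blocks. c X * (\<Sum>m\<in>M. sigma_char G X (g \<otimes> m)))"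
      unfolding fun_cong[OF c] sum_distrib_left by (rule sum.swap)
    also have "\<dots> = (\<Sum>X\<in>irr_blocks. c X * (of_nat (card M) * sigma_char G X g))"
      by (intro sum.cong refl) (simp add: avg)
    also have "\<dots> = of_nat (card M) * (\<Sum>X\<in>irr_blocks. c X * sigma_char G X g)"
      by (simp add: sum_distrib_left mult.left_commute)
    also have "\<dots> = of_nat (card M)"
      using fun_cong[OF c, of g] superclass_self[OF gc] by simp
    finally have "(\<Sum>m\<in>M. ?ind (g \<otimes> m)) = of_nat (card M)" .
    moreover have "(\<Sum>m\<in>M. ?ind (g \<otimes> m)) = of_nat (card {m \<in> M. g \<otimes> m \<in> ?K})"
      using finite_M by (simp add: sum.If_cases Int_def)
    ultimately have "card {m \<in> M. g \<otimes> m \<in> ?K} = card M" by simp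
    then have "{m \<in> M. g \<otimes> m \<in> ?K} = M" using finite_M by (intro card_subset_eq) auto
    then show "g \<otimes> m \<in> ?K" using m by blast
  qed
next
  assume C: ?C
  show ?V
  proof (intro ballI, rule ccontr)
    fix g \<chi> assume g: "g \<in> carrier G - N" and \<chi>: "\<chi> \<in> supercharacters_over G S M" and nz: "\<chi> g \<noteq> 0"
    obtain X where X: "X \<in> irr_blocks" "\<chi> = sigma_char G X"
      using \<chi> by (auto simp: supercharacters_over_def supercharacters_eq)
    have gc: "g \<in> carrier G" using g by simp
    obtain w where w: "\<And>g. g \<in> carrier G \<Longrightarrow> (\<Sum>m\<in>M. \<chi> (g \<otimes> m)) = of_nat (card M) * (w * \<chi> g)"
      using sum_coset_sigma_char[OF X(1)] X(2) by blast
    have "(\<Sum>m\<in>M. \<chi> (g \<otimes> m)) = (\<Sum>m\<in>M. \<chi> g)"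
    proof (intro sum.cong refl)
      fix m assume "m \<in> M"
      then have "g \<otimes> m \<in> superclass G S g" using C g by blast
      then show "\<chi> (g \<otimes> m) = \<chi> g"
        using sigma_char_block_S[OF X(1)] by (simp add: superclass_def X(2))
    qed
    then have w1: "w = 1" using w[OF gc] nz card_M_nz by simp
    have "\<chi> m = \<chi> \<one>" if m: "m \<in> M" for m
    proof -
      have mc: "m \<in> carrier G" using m M.mem_carrier by blast
      have "of_nat (card M) * \<chi> m = (\<Sum>l\<in>M. \<chi> (m \<otimes> l))" using w[OF mc] w1 by simp
      also have "\<dots> = (\<Sum>l\<in>M. \<chi> l)"
      proof (rule sum.reindex_bij_witness[of _ "\<lambda>l. inv m \<otimes> l" "\<lambda>l. m \<otimes> l"])
        fix l assume "l \<in> M"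
        then show "inv m \<otimes> (m \<otimes> l) = l" "m \<otimes> (inv m \<otimes> l) = l"
          using m M.mem_carrier by (auto simp flip: m_assoc)
      qed (use m in auto)
      also have "\<dots> = (\<Sum>l\<in>M. \<chi> (\<one> \<otimes> l))"
        using M.mem_carrier by (intro sum.cong refl) simp
      also have "\<dots> = of_nat (card M) * \<chi> \<one>" using w[OF one_closed] w1 by simp
      finally show ?thesis using card_M_nz by simp
    qed
    then have "M \<subseteq> char_kernel G \<chi>"
      using M.mem_carrier unfolding char_kernel_def by blast
    then show False using \<chi> by (simp add: supercharacters_over_def)
  qed
qed

lemma vanishing_off_subset_iff:
  assumes N: "subgroup N G"
  shows "vanishing_off_subgroup G S M \<subseteq> N \<longleftrightarrow>
    (\<forall>g\<in>carrier G - N. \<forall>\<chi>\<in>supercharacters_over G S M. \<chi> g = 0)"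
proof -
  let ?H = "{g \<in> carrier G. \<exists>\<chi>\<in>supercharacters_over G S M. \<chi> g \<noteq> 0}"
  have "generate G ?H \<subseteq> N \<longleftrightarrow> ?H \<subseteq> N"
    using generate_subgroup_incl[OF _ N] generate.incl[of _ ?H G] by blast
  then show ?thesis unfolding vanishing_off_subgroup_def by blast
qed

section \<open>Saturated superclasses and the Delta-product\<close>

definition saturation :: "'a set \<Rightarrow> 'a set" where
  "saturation K = \<Union>((\<lambda>g. M #> g) ` K)"

lemma saturation_iff:
  assumes "K \<subseteq> carrier G"
  shows "h \<in> saturation K \<longleftrightarrow> (\<exists>k\<in>K. \<exists>m\<in>M. h = k \<otimes> m)"
  using mem_rcos_iff assms by (auto simp: saturation_def) blast+

lemma subset_saturation: "K \<subseteq> carrier G \<Longrightarrow> K \<subseteq> saturation K"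
  using saturation_iff[of K] M.one_closed r_one by (metis subset_iff)

lemma saturation_subset_carrier: "K \<subseteq> carrier G \<Longrightarrow> saturation K \<subseteq> carrier G"
  using r_coset_subset_G[OF M.subset] unfolding saturation_def by blast

text \<open>
  The saturation \<open>KM\<close> is a union of superclasses: it is the set where the coset averages of
  the indicator of \<open>K\<close> are nonzero, and the function of these averages belongs to \<open>S\<close>.
\<close>

lemma saturation_union_of_superclasses:
  assumes K: "K \<in> Cl G S" and g: "g \<in> carrier G" and h: "h \<in> superclass G S g"
    and m: "m \<in> M" "g \<otimes> m \<in> K"
  obtains m' where "m' \<in> M" "h \<otimes> m' \<in> K"
proof -
  let ?ind = "\<lambda>h. if h \<in> K then 1 else (0::complex)"
  have hc: "h \<in> carrier G" using h superclass_subset by blast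
  have count: "(\<Sum>m\<in>M. ?ind (x \<otimes> m)) = of_nat (card {m \<in> M. x \<otimes> m \<in> K})" for x
    using finite_M by (simp add: sum.If_cases Int_def)
  have "convolution G averaging ?ind \<in> S"
    by (intro convolution_S averaging_S indicator_S K)
  then have "convolution G averaging ?ind h = convolution G averaging ?ind g"
    using h by (simp add: superclass_def)
  then have "card {m \<in> M. h \<otimes> m \<in> K} = card {m \<in> M. g \<otimes> m \<in> K}"
    using card_M_nz by (simp only: convolution_averaging[OF hc] convolution_averaging[OF g] count
        divide_cancel_right of_nat_eq_iff simp_thms)
  moreover have "card {m \<in> M. g \<otimes> m \<in> K} \<noteq> 0" using m finite_M by auto
  ultimately have "{m \<in> M. h \<otimes> m \<in> K} \<noteq> {}" by force
  then show ?thesis using that by blast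
qed

text \<open>
  Images of different superclasses can overlap only if they are equal: if the image of \<open>L\<close>
  meets that of \<open>K\<close>, then \<open>L\<close> meets the union of superclasses \<open>KM\<close>, hence \<open>L \<subseteq> KM\<close>.
\<close>

lemma partition_quotient_classes:
  "partition_on (carrier (G Mod M)) ((\<lambda>K. (\<lambda>g. M #> g) ` K) ` Cl G S)"
proof -
  let ?q = "\<lambda>K. (\<lambda>g. M #> g) ` K"
  have sub: "?q L \<subseteq> ?q K" if K: "K \<in> Cl G S" and L: "L \<in> Cl G S" and c: "c \<in> ?q K" "c \<in> ?q L" for K L c
  proof
    fix d assume "d \<in> ?q L"
    then obtain l' where l': "l' \<in> L" "d = M #> l'" by blast
    obtain k l where kl: "k \<in> K" "l \<in> L" "M #> k = M #> l" using c by auto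
    have kc: "k \<in> carrier G" and lc: "l \<in> carrier G" and lc': "l' \<in> carrier G"
      using kl l' K L superclass_subset by (auto simp: Cl_def)
    have "k \<in> M #> l" using rcos_self[OF kc M.subgroup_axioms] kl(3) by simp
    then obtain m where m: "m \<in> M" "l \<otimes> m \<in> K" using mem_rcos_iff[OF lc] kl(1) by auto
    have "l' \<in> superclass G S l"
      using L kl(2) l'(1) superclass_eq by (auto simp: Cl_def)
    then obtain m' where m': "m' \<in> M" "l' \<otimes> m' \<in> K"
      using saturation_union_of_superclasses[OF K lc _ m] by blast
    then show "d \<in> ?q K" using rcos_mult_right[OF lc' m'(1)] l'(2) by (metis imageI)
  qed
  show ?thesis
  proof (rule partition_onI)
    have "\<Union>(?q ` Cl G S) = ?q (\<Union>(Cl G S))" by blast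
    also have "\<Union>(Cl G S) = carrier G" using partition_on_def partition_Cl by metis
    finally show "\<Union>(?q ` Cl G S) = carrier (G Mod M)"
      by (auto simp: FactGroup_def RCOSETS_def)
    show "disjnt p q" if pq: "p \<in> ?q ` Cl G S" "q \<in> ?q ` Cl G S" "p \<noteq> q" for p q
    proof (rule ccontr)
      assume "\<not> disjnt p q"
      then obtain c where c: "c \<in> p" "c \<in> q" by (auto simp: disjnt_iff)
      obtain K L where "K \<in> Cl G S" "L \<in> Cl G S" "p = ?q K" "q = ?q L" using pq by blast
      then show False using sub c pq(3) by (metis subset_antisym)
    qed
    show "{} \<notin> ?q ` Cl G S" using partition_onD3[OF partition_Cl] by blast
  qed
qed

lemma superclass_quotient:
  assumes g: "g \<in> carrier G"
  shows "superclass (G Mod M) (quotient_theory G S M) (M #> g) = (\<lambda>h. M #> h) ` superclass G S g"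
  unfolding quotient_theory_def
  by (rule superclass_theory_with_classes[OF partition_quotient_classes])
    (use g superclass_self in \<open>auto simp: Cl_def\<close>)

lemma card_saturation:
  assumes "K \<subseteq> carrier G"
  shows "card (saturation K) = card ((\<lambda>g. M #> g) ` K) * card M"
proof -
  let ?q = "(\<lambda>g. M #> g) ` K"
  have q: "?q \<subseteq> rcosets M" using assms by (auto simp: RCOSETS_def)
  have "finite K" using assms finite_carrier finite_subset by blast
  then have fq: "finite ?q" by simp
  have "card (\<Union>?q) = (\<Sum>C\<in>?q. card C)"
  proof (rule card_Union_disjoint)
    show "disjoint ?q"
      using q rcos_disjoint[OF M.subgroup_axioms] by (meson pairwise_subset)
    show "finite C" if "C \<in> ?q" for C
    proof -
      have "C \<in> rcosets M" using that q by blast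
      then show ?thesis by (rule rcosets_finite[OF _ M.subset finite_M])
    qed
  qed
  also have "\<dots> = (\<Sum>C\<in>?q. card M)"
    using q card_rcosets_equal M.subset by (intro sum.cong) auto
  finally show ?thesis by (simp add: saturation_def)
qed

lemma card_condition_iff:
  assumes g: "g \<in> carrier G"
  shows "card (superclass G S g) =
      card (superclass (G Mod M) (quotient_theory G S M) (M #> g)) * card M \<longleftrightarrow>
    saturation (superclass G S g) = superclass G S g"
proof -
  let ?K = "superclass G S g"
  have "card (superclass (G Mod M) (quotient_theory G S M) (M #> g)) * card M = card (saturation ?K)"
    using superclass_quotient[OF g] card_saturation[OF superclass_subset] by simp
  moreover have "finite (saturation ?K)"
    using saturation_subset_carrier[OF superclass_subset] finite_carrier finite_subset by blast
  ultimately show ?thesis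
    using subset_saturation[OF superclass_subset] card_subset_eq by metis
qed

lemma saturated_iff:
  assumes N: "S_normal G S N"
  shows "(\<forall>g\<in>carrier G - N. saturation (superclass G S g) = superclass G S g) \<longleftrightarrow>
    (\<forall>g\<in>carrier G - N. \<forall>m\<in>M. g \<otimes> m \<in> superclass G S g)" (is "?A \<longleftrightarrow> ?C")
proof
  assume ?A
  show ?C
  proof (intro ballI)
    fix g m assume g: "g \<in> carrier G - N" and m: "m \<in> M"
    then have "g \<otimes> m \<in> saturation (superclass G S g)"
      using saturation_iff[OF superclass_subset] superclass_self by blast
    then show "g \<otimes> m \<in> superclass G S g" using \<open>?A\<close> g by blast
  qed
next
  assume C: ?C
  show ?A
  proof (intro ballI subset_antisym)
    fix g assume g: "g \<in> carrier G - N"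
    show "superclass G S g \<subseteq> saturation (superclass G S g)"
      by (rule subset_saturation[OF superclass_subset])
    show "saturation (superclass G S g) \<subseteq> superclass G S g"
    proof
      fix x assume "x \<in> saturation (superclass G S g)"
      then obtain k m where km: "k \<in> superclass G S g" "m \<in> M" "x = k \<otimes> m"
        using saturation_iff[OF superclass_subset] by blast
      then have "k \<in> carrier G - N"
        using S_normal_superclass[OF N km(1)] g superclass_subset by blast
      then have "x \<in> superclass G S k" using C km by blast
      then show "x \<in> superclass G S g" using superclass_eq[OF km(1)] by simp
    qed
  qed
qed

lemma preimage_eq_saturation:
  assumes "K \<subseteq> carrier G"
  shows "{g \<in> carrier G. M #> g \<in> (\<lambda>k. M #> k) ` K} = saturation K"
proof (intro subset_antisym subsetI)
  fix g assume "g \<in> {g \<in> carrier G. M #> g \<in> (\<lambda>k. M #> k) ` K}"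
  then show "g \<in> saturation K"
    using rcos_self[OF _ M.subgroup_axioms, of g] by (auto simp: saturation_def)
next
  fix g assume g: "g \<in> saturation K"
  then obtain k m where km: "k \<in> K" "m \<in> M" "g = k \<otimes> m" using saturation_iff[OF assms] by blast
  then have "M #> g = M #> k" using rcos_mult_right assms by blast
  then show "g \<in> {g \<in> carrier G. M #> g \<in> (\<lambda>k. M #> k) ` K}"
    using g saturation_subset_carrier[OF assms] km(1) by blast
qed

text \<open>
  The superclasses of the restriction are those inside \<open>N\<close>; those of the deflation are the
  images of superclasses, and the preimage of the image of \<open>K\<close> is its saturation.
\<close>

lemma delta_product_eq:
  assumes N: "S_normal G S N" and MN: "M \<subseteq> N"
  shows "delta_product G M N (restricted_theory G S N) (quotient_theory G S M) =
    theory_with_classes G ({K \<in> Cl G S. K \<subseteq> N} \<union> saturation ` {K \<in> Cl G S. \<not> K \<subseteq> N})"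
proof -
  interpret N: subgroup N G by (rule S_normal_subgroup[OF N])
  let ?q = "\<lambda>K. (\<lambda>g. M #> g) ` K"
  have Kc: "K \<subseteq> carrier G" if "K \<in> Cl G S" for K
    using that superclass_subset by (auto simp: Cl_def)
  have "partition_on N {K \<in> Cl G S. K \<subseteq> N}"
  proof (rule partition_onI)
    obtain \<K> where "\<K> \<subseteq> Cl G S" "N = \<Union>\<K>" using N by (auto simp: S_normal_def)
    then show "\<Union>{K \<in> Cl G S. K \<subseteq> N} = N" by blast
    show "disjnt p q" if "p \<in> {K \<in> Cl G S. K \<subseteq> N}" "q \<in> {K \<in> Cl G S. K \<subseteq> N}" "p \<noteq> q" for p q
      using that partition_onD2[OF partition_Cl] by (auto simp: disjoint_def disjnt_def)
    show "{} \<notin> {K \<in> Cl G S. K \<subseteq> N}" using partition_onD3[OF partition_Cl] by blast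
  qed
  then have restr: "Cl (G\<lparr>carrier := N\<rparr>) (restricted_theory G S N) = {K \<in> Cl G S. K \<subseteq> N}"
    unfolding restricted_theory_def by (intro Cl_theory_with_classes) simp
  have quot: "Cl (G Mod M) (quotient_theory G S M) = ?q ` Cl G S"
    unfolding quotient_theory_def by (rule Cl_theory_with_classes[OF partition_quotient_classes])
  have sub: "?q K \<subseteq> ?q N \<longleftrightarrow> K \<subseteq> N" if K: "K \<in> Cl G S" for K
  proof
    assume q: "?q K \<subseteq> ?q N"
    show "K \<subseteq> N"
    proof
      fix k assume k: "k \<in> K"
      then obtain n where n: "n \<in> N" "M #> k = M #> n" using q by blast
      have "k \<in> M #> k" using rcos_self[OF _ M.subgroup_axioms] Kc[OF K] k by blast
      then obtain m where "m \<in> M" "k = n \<otimes> m" using mem_rcos_iff[of n k] n N.mem_carrier by auto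
      then show "k \<in> N" using n MN by blast
    qed
  qed blast
  have "{{g \<in> carrier G. M #> g \<in> D} | D. D \<in> ?q ` Cl G S \<and> \<not> D \<subseteq> ?q N} =
    saturation ` {K \<in> Cl G S. \<not> K \<subseteq> N}" (is "?L = ?R")
  proof (intro subset_antisym subsetI)
    fix A assume "A \<in> ?L"
    then obtain K where "K \<in> Cl G S" "\<not> ?q K \<subseteq> ?q N" "A = {g \<in> carrier G. M #> g \<in> ?q K}" by blast
    then show "A \<in> ?R" using sub preimage_eq_saturation[OF Kc] by blast
  next
    fix A assume "A \<in> ?R"
    then obtain K where "K \<in> Cl G S" "\<not> K \<subseteq> N" "A = saturation K" by blast
    then have "K \<in> Cl G S" "\<not> ?q K \<subseteq> ?q N" "A = {g \<in> carrier G. M #> g \<in> ?q K}"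
      using sub preimage_eq_saturation[OF Kc] by simp_all
    then show "A \<in> ?L" by blast
  qed
  then show ?thesis unfolding delta_product_def restr quot by simp
qed

text \<open>
  If \<open>S\<close> equals the Delta-product, the indicator of a superclass \<open>K\<close> outside \<open>N\<close> is constant
  on the saturation of \<open>K\<close>, which is therefore contained in \<open>K\<close>.
\<close>

lemma is_delta_product_iff:
  assumes N: "S_normal G S N" and MN: "M \<subseteq> N"
  shows "is_delta_product G S M N \<longleftrightarrow>
    (\<forall>g\<in>carrier G - N. saturation (superclass G S g) = superclass G S g)" (is "_ \<longleftrightarrow> ?A")
proof
  assume D: "is_delta_product G S M N"
  show ?A
  proof (intro ballI subset_antisym)
    fix g assume g: "g \<in> carrier G - N"
    let ?K = "superclass G S g"
    have K: "?K \<in> Cl G S" "\<not> ?K \<subseteq> N" using g superclass_self by (auto simp: Cl_def)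
    show "?K \<subseteq> saturation ?K" by (rule subset_saturation[OF superclass_subset])
    have "(\<lambda>h. if h \<in> ?K then 1 else 0) \<in> S" using indicator_S[OF K(1)] .
    then have "(\<lambda>h. if h \<in> ?K then 1 else 0) \<in> theory_with_classes G
        ({K \<in> Cl G S. K \<subseteq> N} \<union> saturation ` {K \<in> Cl G S. \<not> K \<subseteq> N})"
      using D delta_product_eq[OF N MN] by (simp add: is_delta_product_def)
    then have const: "(if x \<in> ?K then 1 else (0::complex)) = (if y \<in> ?K then 1 else 0)"
      if "x \<in> saturation ?K" "y \<in> saturation ?K" for x y
      using that K unfolding theory_with_classes_def by blast
    show "saturation ?K \<subseteq> ?K"
    proof
      fix x assume "x \<in> saturation ?K"
      moreover have "g \<in> saturation ?K" "g \<in> ?K"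
        using g superclass_self subset_saturation[OF superclass_subset] by blast+
      ultimately show "x \<in> ?K" using const[of x g] by (simp split: if_splits)
    qed
  qed
next
  assume A: ?A
  have "saturation K = K" if K: "K \<in> Cl G S" "\<not> K \<subseteq> N" for K
  proof -
    obtain g where g: "g \<in> carrier G" "K = superclass G S g" using K(1) by (auto simp: Cl_def)
    then have "g \<notin> N" using K(2) S_normal_superclass[OF N] by blast
    then show ?thesis using A g by blast
  qed
  then have "{K \<in> Cl G S. K \<subseteq> N} \<union> saturation ` {K \<in> Cl G S. \<not> K \<subseteq> N} = Cl G S"
    by (auto simp: image_iff)
  then show "is_delta_product G S M N"
    unfolding is_delta_product_def delta_product_eq[OF N MN] using S_eq_theory_with_classes by simp
qed

end

section \<open>Equivalent conditions for a Delta-product\<close>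

theorem theorem5p3:
  fixes G :: "('a, 'b) monoid_scheme"
    and S :: "('a \<Rightarrow> complex) set"
    and M N :: "'a set"
  assumes "group G" and "finite (carrier G)"
    and "supercharacter_theory G S"
    and "S_normal G S M" and "S_normal G S N" and "M \<subseteq> N"
  shows
    "(is_delta_product G S M N
       \<longleftrightarrow> (\<forall>g\<in>carrier G - N.
              card (superclass G S g) =
                card (superclass (G Mod M) (quotient_theory G S M) (M #>\<^bsub>G\<^esub> g)) * card M)) \<and>
     (is_delta_product G S M N
       \<longleftrightarrow> (\<forall>g\<in>carrier G - N. \<forall>\<chi>\<in>supercharacters_over G S M. \<chi> g = 0)) \<and>
     (is_delta_product G S M N
       \<longleftrightarrow> vanishing_off_subgroup G S M \<subseteq> N) \<and>
     (is_delta_product G S M N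
       \<longleftrightarrow> (\<forall>g\<in>carrier G - N. \<forall>m\<in>M. \<exists>k\<in>superclass G S g. inv\<^bsub>G\<^esub> g \<otimes>\<^bsub>G\<^esub> k = m))"
proof -
  interpret group G by fact
  interpret supercharacter_group_normal G S M
    by unfold_locales (use assms in auto)
  \<comment> \<open>The common meaning of all the conditions: outside \<open>N\<close> a superclass is a union of cosets of \<open>M\<close>.\<close>
  let ?C = "\<forall>g\<in>carrier G - N. \<forall>m\<in>M. g \<otimes>\<^bsub>G\<^esub> m \<in> superclass G S g"
  have delta: "is_delta_product G S M N \<longleftrightarrow> ?C"
    using is_delta_product_iff[OF assms(5,6)] saturated_iff[OF assms(5)] by simp
  have card: "(\<forall>g\<in>carrier G - N.
      card (superclass G S g) =
        card (superclass (G Mod M) (quotient_theory G S M) (M #>\<^bsub>G\<^esub> g)) * card M) \<longleftrightarrow> ?C"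
    using card_condition_iff saturated_iff[OF assms(5)] by auto
  have vanish: "(\<forall>g\<in>carrier G - N. \<forall>\<chi>\<in>supercharacters_over G S M. \<chi> g = 0) \<longleftrightarrow> ?C"
    by (rule supercharacters_over_vanish_iff[OF assms(5,6)])
  have "(\<exists>k\<in>superclass G S g. inv\<^bsub>G\<^esub> g \<otimes>\<^bsub>G\<^esub> k = m) \<longleftrightarrow> g \<otimes>\<^bsub>G\<^esub> m \<in> superclass G S g"
    if g: "g \<in> carrier G" and m: "m \<in> M" for g m
  proof
    have mc: "m \<in> carrier G" using m M.mem_carrier by blast
    show "g \<otimes>\<^bsub>G\<^esub> m \<in> superclass G S g" if ex: "\<exists>k\<in>superclass G S g. inv\<^bsub>G\<^esub> g \<otimes>\<^bsub>G\<^esub> k = m"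
    proof -
      obtain k where k: "k \<in> superclass G S g" "inv\<^bsub>G\<^esub> g \<otimes>\<^bsub>G\<^esub> k = m" using ex by blast
      then have "k \<in> carrier G" using superclass_subset by blast
      then have "g \<otimes>\<^bsub>G\<^esub> m = k" using k(2) g inv_solve_left' by (metis mc)
      then show ?thesis using k(1) by simp
    qed
    show "\<exists>k\<in>superclass G S g. inv\<^bsub>G\<^esub> g \<otimes>\<^bsub>G\<^esub> k = m" if "g \<otimes>\<^bsub>G\<^esub> m \<in> superclass G S g"
      using that g mc by (intro bexI[of _ "g \<otimes>\<^bsub>G\<^esub> m"]) (simp_all flip: m_assoc)
  qed
  then have elem: "(\<forall>g\<in>carrier G - N. \<forall>m\<in>M. \<exists>k\<in>superclass G S g. inv\<^bsub>G\<^esub> g \<otimes>\<^bsub>G\<^esub> k = m) \<longleftrightarrow> ?C"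
    by simp
  have gen: "vanishing_off_subgroup G S M \<subseteq> N \<longleftrightarrow> ?C"
    using vanishing_off_subset_iff[OF S_normal_subgroup[OF assms(5)]] vanish by simp
  show ?thesis unfolding delta card vanish gen elem by simp
qed

end
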